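(* Consider the general linear equation of order $n$ in reduced normal form $$y^{(n)}+c_{n-2}\,y^{(n-2)}+c_{n-3}\,y^{(n-3)}+\dots+c_0\,y=0,$$ and set $c_n=1$, $c_{n-1}=0$. The generators $X_n$ of $G_S$ and $X_n^0$ of $G_c$ have the following expressions, where $f,h$ are arbitrary functions of $x$, $k_1$ is an arbitrary constant, $\delta_0^k$ denotes the Kronecker delta, and $\binom{m}{l}=0$ for $l>m$. (a) $$X_n=f\,\partial_x+\left[y\left(\frac{n-1}{2}f'+k_1\right)+h\right]\partial_y+\sum_{k=0}^{n-2}\Phi_k^n\,\partial_{c_k},$$ where for $k=0,\dots,n-2$ $$\Phi_k^n=-(n-k)f'c_k+\sum_{j=1}^{n-k}c_{k+j}\left[\binom{k+j}{j+1}-\binom{k+j}{j}\frac{n-1}{2}\right]f^{(j+1)}+\delta_0^k\left[-c_k\frac{h}{y}+\sum_{j=1}^{n-k}c_{k+j}\binom{k+j}{j}\frac{h^{(j)}}{y}\right].$$ (b) $$X_n^0=f\,\partial_x+\sum_{k=0}^{n-2}\Phi_k^n\,\partial_{c_k},$$ where for $k=0,\dots,n-2$ $$\Phi_k^n=-(n-k)c_kf'+\sum_{j=1}^{n-k}c_{k+j}\left[\binom{k+j}{j+1}-\binom{k+j}{j}\frac{n-1}{2}\right]f^{(j+1)}.$$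
   Context: $G_S$ denotes the symmetry group of the general equation of the given form when the coefficients $c_0,\dots,c_{n-2}$ (arbitrary functions of $x$) are regarded as additional dependent variables besides $y$: its infinitesimal generators are the vector fields $X=\xi\partial_x+\eta\partial_y+\sum_k\phi_k\partial_{c_k}$ whose $n$-th prolongation $X^{[n]}$ annihilates $\Delta=y^{(n)}+\sum_{k=0}^{n-2}c_ky^{(k)}$ whenever $\Delta=0$. The equivalence group $G$ of the reduced normal form is the pseudo group of invertible point transformations $x=T(z)$, $y=\lambda\,[T'(z)]^{(n-1)/2}w(z)$ with $T$ an arbitrary function and $\lambda$ an arbitrary constant; its infinitesimal generator is $f(x)\partial_x+y\left(\frac{n-1}{2}f'(x)+k_1\right)\partial_y$. $G_c$ is the pseudo group of transformations induced by $G$ through its action on the coefficients of the equation; its generators are obtained from $X_n$ by imposing the minimal set of conditions under which the projection of $X_n$ on the $(x,y)$-space becomes the infinitesimal generator of $G$, and then dropping the $\partial_y$ term.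
   Formalization: The printed sign in (a) is wrong: the δ-bracket must read −[c_k h/y + Σ_{j≥1} c_{k+j} binom(k+j,j) h^{(j)}/y]; with n=2, f=0, k_1=0, h=x² the printed field is not a symmetry. Stated for n≥2, smooth fields on open boxes with y≠0. *)

theory Defs
  imports "HOL-Analysis.Analysis"
begin

text \<open>Jet coordinates for one independent variable \<open>x\<close> and the dependent variables
  \<open>y, c\<^sub>0, \<dots>, c\<^sub>n\<^sub>-\<^sub>2\<close>; the coordinate \<open>Jet v j\<close> stands for the \<open>j\<close>-th derivative of \<open>v\<close>.\<close>

datatype dvar = DepY | Coef nat
datatype jcoord = Indep | Jet dvar nat

type_synonym jet = "jcoord \<Rightarrow> real"

definition dvars :: "nat \<Rightarrow> dvar set" where
  "dvars n = insert DepY (Coef ` {..<n - 1})"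

definition jcoords :: "nat \<Rightarrow> nat \<Rightarrow> jcoord set" where
  "jcoords n m = insert Indep {Jet v j | v j. v \<in> dvars n \<and> j \<le> m}"

text \<open>The \<open>m\<close>-th jet space over the box whose sides are the sets \<open>B i\<close>, for the base
  coordinates \<open>i \<in> jcoords n 0\<close>. Elements are extensional, so that a
  function on it cannot depend on coordinates outside \<open>jcoords n m\<close>.\<close>

definition jet_space :: "nat \<Rightarrow> nat \<Rightarrow> (jcoord \<Rightarrow> real set) \<Rightarrow> jet set" where
  "jet_space n m B = (\<Pi>\<^sub>E i\<in>jcoords n m. if i \<in> jcoords n 0 then B i else UNIV)"

abbreviation base_space :: "nat \<Rightarrow> (jcoord \<Rightarrow> real set) \<Rightarrow> jet set" where
  "base_space n B \<equiv> jet_space n 0 B"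

definition base :: "nat \<Rightarrow> jet \<Rightarrow> jet" where
  "base n p = restrict p (jcoords n 0)"

definition pd :: "jcoord \<Rightarrow> (jet \<Rightarrow> real) \<Rightarrow> jet \<Rightarrow> real" where
  "pd i F p = deriv (\<lambda>t. F (p(i := t))) (p i)"

text \<open>\<open>C\<^sup>\<infinity>\<close>: all iterated partial derivatives exist and are continuous.\<close>

definition smooth_base :: "nat \<Rightarrow> (jcoord \<Rightarrow> real set) \<Rightarrow> (jet \<Rightarrow> real) \<Rightarrow> bool" where
  "smooth_base n B F \<longleftrightarrow>
     (\<forall>is. set is \<subseteq> jcoords n 0 \<longrightarrow>
        continuous_on (base_space n B) (foldr pd is F) \<and>
        (\<forall>i\<in>jcoords n 0. \<forall>p\<in>base_space n B.
           (\<lambda>t. foldr pd is F (p(i := t))) differentiable (at (p i))))"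

definition smooth_real :: "real set \<Rightarrow> (real \<Rightarrow> real) \<Rightarrow> bool" where
  "smooth_real I f \<longleftrightarrow> (\<forall>j. \<forall>x\<in>I. (deriv ^^ j) f differentiable (at x))"

text \<open>Total derivative, as an operator from functions on the \<open>m\<close>-th jet space to functions
  on the \<open>(m + 1)\<close>-st.\<close>

definition total_deriv :: "nat \<Rightarrow> nat \<Rightarrow> (jet \<Rightarrow> real) \<Rightarrow> jet \<Rightarrow> real" where
  "total_deriv n m F p =
     pd Indep F p + (\<Sum>v\<in>dvars n. \<Sum>j\<le>m. p (Jet v (Suc j)) * pd (Jet v j) F p)"

text \<open>A vector field \<open>\<xi> \<partial>\<^sub>x + \<Sum>\<^sub>v \<phi>\<^sub>v \<partial>\<^sub>v\<close> on the base space is given by its components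
  \<open>\<xi>\<close> and \<open>\<phi> v\<close> for \<open>v \<in> dvars n\<close>. The coefficient of \<open>\<partial>/\<partial>v\<^sup>(\<^sup>j\<^sup>)\<close> in its prolongation:\<close>

fun prolong_coeff ::
  "nat \<Rightarrow> (jet \<Rightarrow> real) \<Rightarrow> (dvar \<Rightarrow> jet \<Rightarrow> real) \<Rightarrow> dvar \<Rightarrow> nat \<Rightarrow> jet \<Rightarrow> real" where
  "prolong_coeff n \<xi> \<phi> v 0 = (\<lambda>p. \<phi> v (base n p))"
| "prolong_coeff n \<xi> \<phi> v (Suc j) =
     (\<lambda>p. total_deriv n j (prolong_coeff n \<xi> \<phi> v j) p
        - p (Jet v (Suc j)) * total_deriv n 0 (\<lambda>q. \<xi> (base n q)) p)"

definition prolongation ::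
  "nat \<Rightarrow> nat \<Rightarrow> (jet \<Rightarrow> real) \<Rightarrow> (dvar \<Rightarrow> jet \<Rightarrow> real) \<Rightarrow> (jet \<Rightarrow> real) \<Rightarrow> jet \<Rightarrow> real" where
  "prolongation n m \<xi> \<phi> F p =
     \<xi> (base n p) * pd Indep F p
     + (\<Sum>v\<in>dvars n. \<Sum>j\<le>m. prolong_coeff n \<xi> \<phi> v j p * pd (Jet v j) F p)"

definition Delta :: "nat \<Rightarrow> jet \<Rightarrow> real" where
  "Delta n p = p (Jet DepY n) + (\<Sum>k<n - 1. p (Jet (Coef k) 0) * p (Jet DepY k))"

definition generator_GS ::
  "nat \<Rightarrow> (jcoord \<Rightarrow> real set) \<Rightarrow> (jet \<Rightarrow> real) \<Rightarrow> (dvar \<Rightarrow> jet \<Rightarrow> real) \<Rightarrow> bool" where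
  "generator_GS n B \<xi> \<phi> \<longleftrightarrow>
     smooth_base n B \<xi> \<and> (\<forall>v\<in>dvars n. smooth_base n B (\<phi> v)) \<and>
     (\<forall>p\<in>jet_space n n B. Delta n p = 0 \<longrightarrow> prolongation n n \<xi> \<phi> (Delta n) p = 0)"

text \<open>The projection of the vector field on the \<open>(x, y)\<close>-space is the infinitesimal generator
  \<open>f \<partial>\<^sub>x + y ((n - 1)/2 f' + k\<^sub>1) \<partial>\<^sub>y\<close> of the equivalence group \<open>G\<close>, whose elements are
  \<open>x = T(z)\<close>, \<open>y = \<lambda> T'(z)\<^sup>(\<^sup>n\<^sup>-\<^sup>1\<^sup>)\<^sup>/\<^sup>2 w(z)\<close>.\<close>

definition projects_to_generator_G ::
  "nat \<Rightarrow> (jcoord \<Rightarrow> real set) \<Rightarrow> (jet \<Rightarrow> real) \<Rightarrow> (dvar \<Rightarrow> jet \<Rightarrow> real) \<Rightarrow> bool" where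
  "projects_to_generator_G n B \<xi> \<phi> \<longleftrightarrow>
     (\<exists>f k\<^sub>1. smooth_real (B Indep) f \<and>
        (\<forall>p\<in>base_space n B.
           \<xi> p = f (p Indep) \<and>
           \<phi> DepY p = p (Jet DepY 0) * ((real n - 1) / 2 * deriv f (p Indep) + k\<^sub>1)))"

text \<open>Coordinates \<open>(x, c\<^sub>0, \<dots>, c\<^sub>n\<^sub>-\<^sub>2)\<close> on which the induced group \<open>G\<^sub>c\<close> acts.\<close>

definition coef_coords :: "nat \<Rightarrow> jcoord set" where
  "coef_coords n = insert Indep ((\<lambda>k. Jet (Coef k) 0) ` {..<n - 1})"

definition coef_space :: "nat \<Rightarrow> (jcoord \<Rightarrow> real set) \<Rightarrow> jet set" where
  "coef_space n B = (\<Pi>\<^sub>E i\<in>coef_coords n. B i)"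

text \<open>\<open>\<zeta> \<partial>\<^sub>x + \<Sum>\<^sub>k \<psi>\<^sub>k \<partial>\<^sub>c\<^sub>k\<close>, a vector field on the \<open>(x, c)\<close>-space, arises from a generator of
  \<open>G\<^sub>S\<close> that projects to a generator of \<open>G\<close> by dropping its \<open>\<partial>\<^sub>y\<close> term.\<close>

definition generator_Gc ::
  "nat \<Rightarrow> (jcoord \<Rightarrow> real set) \<Rightarrow> (jet \<Rightarrow> real) \<Rightarrow> (nat \<Rightarrow> jet \<Rightarrow> real) \<Rightarrow> bool" where
  "generator_Gc n B \<zeta> \<psi> \<longleftrightarrow>
     (\<exists>\<xi> \<phi>. generator_GS n B \<xi> \<phi> \<and> projects_to_generator_G n B \<xi> \<phi> \<and>
        (\<forall>p\<in>base_space n B.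
           \<xi> p = \<zeta> (restrict p (coef_coords n)) \<and>
           (\<forall>k<n - 1. \<phi> (Coef k) p = \<psi> k (restrict p (coef_coords n)))))"

definition coef :: "nat \<Rightarrow> jet \<Rightarrow> nat \<Rightarrow> real" where
  "coef n p k = (if k = n then 1 else if k + 1 = n then 0 else p (Jet (Coef k) 0))"

definition Phi :: "nat \<Rightarrow> (real \<Rightarrow> real) \<Rightarrow> nat \<Rightarrow> jet \<Rightarrow> real" where
  "Phi n f k p =
     - (real n - real k) * deriv f (p Indep) * coef n p k
     + (\<Sum>j = 1..n - k. coef n p (k + j)
          * (real ((k + j) choose (j + 1)) - real ((k + j) choose j) * ((real n - 1) / 2))
          * (deriv ^^ (j + 1)) f (p Indep))"

text \<open>The part of the \<open>\<partial>\<^sub>c\<^sub>0\<close> component that comes from \<open>h \<partial>\<^sub>y\<close>. All terms have the same sign: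
  the symmetry condition for \<open>h \<partial>\<^sub>y + \<phi> \<partial>\<^sub>c\<^sub>0\<close> reads
  \<open>h\<^sup>(\<^sup>n\<^sup>) + c\<^sub>n\<^sub>-\<^sub>2 h\<^sup>(\<^sup>n\<^sup>-\<^sup>2\<^sup>) + \<dots> + c\<^sub>0 h + \<phi> y = 0\<close>. In print the sum over
  \<open>j \<ge> 1\<close> is also found with a plus sign, which is a misprint.\<close>

definition Phi_h :: "nat \<Rightarrow> (real \<Rightarrow> real) \<Rightarrow> nat \<Rightarrow> jet \<Rightarrow> real" where
  "Phi_h n h k p =
     - (coef n p k * (h (p Indep) / p (Jet DepY 0))
        + (\<Sum>j = 1..n - k. coef n p (k + j) * real ((k + j) choose j)
             * ((deriv ^^ j) h (p Indep) / p (Jet DepY 0))))"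

end

theory Submission
  imports Defs
begin

text \<open>
  Write \<open>\<eta>\<close> for the component of the field along \<open>y\<close> and \<open>\<eta>\<^sub>m\<close> for the coefficient of
  \<open>\<partial>/\<partial>y\<^sup>(\<^sup>m\<^sup>)\<close> in its prolongation, so that \<open>\<eta>\<^sub>m\<^sub>+\<^sub>1 = D \<eta>\<^sub>m - y\<^sup>(\<^sup>m\<^sup>+\<^sup>1\<^sup>) D \<xi>\<close>. With
  \<open>\<phi>\<^sub>k\<close> the component along \<open>c\<^sub>k\<close>, the symmetry condition says that
  \<open>\<eta>\<^sub>n + \<Sum> c\<^sub>k \<eta>\<^sub>k + \<Sum> \<phi>\<^sub>k y\<^sup>(\<^sup>k\<^sup>) = 0\<close> wherever \<open>\<Delta> = 0\<close>. The coefficient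
  \<open>\<eta>\<^sub>n\<close> is affine in the coordinates of order \<open>n\<close> with an explicit slope
  (\<open>prolong_y_upd_DepY_top\<close>), so \<open>y\<^sup>(\<^sup>n\<^sup>)\<close> can be eliminated and an identity on the whole jet
  space remains (\<open>reduced_symmetry_condition\<close>).

  Three comparisons in this identity restrict \<open>\<xi>\<close> and \<open>\<eta>\<close>. The slope of \<open>\<eta>\<^sub>n\<close> in
  \<open>c\<^sub>k\<^sup>(\<^sup>n\<^sup>)\<close> must vanish, hence neither \<open>\<xi>\<close> nor \<open>\<eta>\<close> depends on the coefficients
  (\<open>pd_Coef_eq_0\<close>). Now the identity depends on a coefficient \<open>c\<^sub>k\<close> only through its explicit
  occurrences and the \<open>\<phi>\<^sub>m\<close>, which are multiplied by single derivatives of \<open>y\<close>; comparing two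
  values of \<open>c\<^sub>k\<close> therefore leaves \<open>\<eta>\<^sub>k - y\<^sup>(\<^sup>k\<^sup>) \<cdot> slope\<close> up to terms linear in the
  derivatives (\<open>coefficient_shift\<close>). Low values of \<open>k\<close> give \<open>\<xi>\<^sub>y = 0\<close> and, when
  \<open>n \<ge> 4\<close>, \<open>\<eta>\<^sub>y\<^sub>y = 0\<close>; for \<open>n = 2, 3\<close> the latter is read off from explicit formulas for
  \<open>\<eta>\<^sub>2\<close> and \<open>\<eta>\<^sub>3\<close>.

  So \<open>\<xi> = f(x)\<close> and \<open>\<eta> = \<alpha>(x) y + h(x)\<close>, and for such fields Leibniz' rule yields all the
  \<open>\<eta>\<^sub>m\<close> (\<open>prolong_y_affine\<close>). Sorting the symmetry condition by derivatives of \<open>y\<close>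
  (\<open>symmetry_sum_affine\<close>), the coefficient of \<open>y\<^sup>(\<^sup>n\<^sup>-\<^sup>1\<^sup>)\<close> is
  \<open>n \<alpha>' - (n choose 2) f''\<close> and must vanish, since there is no \<open>c\<^sub>n\<^sub>-\<^sub>1\<close>; this is where
  \<open>\<alpha> = (n - 1)/2 f' + k\<^sub>1\<close> comes from. The coefficients of the lower derivatives determine the
  \<open>\<phi>\<^sub>k\<close>. Conversely the same sum vanishes for the listed fields, which moreover are smooth
  because they are sums of products of smooth functions of one coordinate each.

  For the induced group, the requirement that the field project to a generator of \<open>G\<close> forces
  \<open>h = 0\<close>, as \<open>y\<close> is a free variable; the remaining components involve only \<open>x\<close> and the
  coefficients.
\<close>

section \<open>Smooth functions of one real variable\<close>

lemma smooth_real_has_derivative: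
  assumes "smooth_real I f" "x \<in> I"
  shows "((deriv ^^ j) f has_real_derivative (deriv ^^ Suc j) f x) (at x)"
  using assms by (simp add: smooth_real_def DERIV_deriv_iff_real_differentiable)

text \<open>A sequence of functions each of which is the derivative of the preceding one determines all
  derivatives of its first member. This criterion is local on open sets, and closure properties of
  smoothness are obtained from it by naming all derivatives at once.\<close>

lemma iterated_deriv_eqI:
  fixes f :: "real \<Rightarrow> real"
  assumes I: "open I" and F0: "\<And>x. x \<in> I \<Longrightarrow> f x = F 0 x"
    and F: "\<And>j x. x \<in> I \<Longrightarrow> (F j has_real_derivative F (Suc j) x) (at x)"
  shows "x \<in> I \<Longrightarrow> (deriv ^^ j) f x = F j x"
proof (induction j arbitrary: x)
  case (Suc j)
  have "((deriv ^^ j) f has_real_derivative F (Suc j) x) (at x)"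
    by (rule has_field_derivative_transform_within_open[OF F I]) (use Suc in auto)
  then show ?case by (simp add: DERIV_imp_deriv)
qed (simp add: F0)

lemma smooth_realI:
  fixes f :: "real \<Rightarrow> real"
  assumes I: "open I" and F0: "\<And>x. x \<in> I \<Longrightarrow> f x = F 0 x"
    and F: "\<And>j x. x \<in> I \<Longrightarrow> (F j has_real_derivative F (Suc j) x) (at x)"
  shows "smooth_real I f"
  unfolding smooth_real_def
proof (intro allI ballI)
  fix j x assume x: "x \<in> I"
  have "((deriv ^^ j) f has_real_derivative F (Suc j) x) (at x)"
    by (rule has_field_derivative_transform_within_open[OF F I x])
      (use x iterated_deriv_eqI[of I f F, OF assms] in auto)
  then show "(deriv ^^ j) f differentiable (at x)"
    by (auto simp: real_differentiable_def)
qed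

lemma iterated_deriv_zero:
  fixes f :: "real \<Rightarrow> real"
  assumes "open I" "\<And>x. x \<in> I \<Longrightarrow> f x = 0" "x \<in> I"
  shows "(deriv ^^ j) f x = 0"
  by (rule iterated_deriv_eqI[of I f "\<lambda>_ _. 0", OF assms(1)]) (use assms in auto)

lemma iterated_deriv_cong:
  assumes "open I" "smooth_real I g" "\<And>x. x \<in> I \<Longrightarrow> f x = g x" "x \<in> I"
  shows "(deriv ^^ j) f x = (deriv ^^ j) g x"
  by (rule iterated_deriv_eqI[of I f "\<lambda>j. (deriv ^^ j) g", OF assms(1)])
    (use assms smooth_real_has_derivative[OF assms(2)] in auto)

lemma
  assumes "open I" "smooth_real I f" "smooth_real I g"
  shows smooth_real_affine: "smooth_real I (\<lambda>x. a * f x + b * g x + c)" (is ?S)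
    and iterated_deriv_affine: "\<And>j x. x \<in> I \<Longrightarrow> (deriv ^^ j) (\<lambda>x. a * f x + b * g x + c) x =
      a * (deriv ^^ j) f x + b * (deriv ^^ j) g x + (if j = 0 then c else 0)" (is "\<And>j x. _ \<Longrightarrow> ?T j x")
proof -
  let ?F = "\<lambda>j x. a * (deriv ^^ j) f x + b * (deriv ^^ j) g x + (if j = 0 then c else 0)"
  have F: "(?F j has_real_derivative ?F (Suc j) x) (at x)" if "x \<in> I" for j x
    using smooth_real_has_derivative[OF assms(2) that, of j]
      smooth_real_has_derivative[OF assms(3) that, of j]
    by (cases j) (auto intro!: derivative_eq_intros)
  show ?S by (rule smooth_realI[of I _ ?F, OF assms(1) _ F]) auto
  show "?T j x" if "x \<in> I" for j x
    by (rule iterated_deriv_eqI[of I _ ?F, OF assms(1) _ F that]) auto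
qed

lemma smooth_real_deriv:
  assumes "open I" "smooth_real I f"
  shows "smooth_real I ((deriv ^^ k) f)"
  by (rule smooth_realI[of I _ "\<lambda>j. (deriv ^^ (j + k)) f", OF assms(1)])
    (use smooth_real_has_derivative[OF assms(2)] in auto)

lemma smooth_real_const: "open I \<Longrightarrow> smooth_real I (\<lambda>_. c)"
  by (rule smooth_realI[of I _ "\<lambda>j _. if j = 0 then c else 0"]) auto

lemma smooth_real_ident: "open I \<Longrightarrow> smooth_real I (\<lambda>x. x)"
  by (rule smooth_realI[of I _ "\<lambda>j x. if j = 0 then x else if j = 1 then 1 else 0"])
    (auto intro!: derivative_eq_intros)

lemma smooth_real_inverse:
  assumes "open I" "0 \<notin> I"
  shows "smooth_real I (\<lambda>x. 1 / x)"
proof (rule smooth_realI[OF assms(1)])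
  let ?F = "\<lambda>j x :: real. (- 1) ^ j * fact j * inverse x ^ Suc j"
  show "1 / x = ?F 0 x" for x by (simp add: inverse_eq_divide)
  show "(?F j has_real_derivative ?F (Suc j) x) (at x)" if "x \<in> I" for j x
  proof -
    have "x \<noteq> 0" using assms that by auto
    from DERIV_cmult[OF DERIV_power_Suc[OF DERIV_inverse[OF this]], of "(- 1) ^ j * fact j" j]
    show ?thesis by (simp add: algebra_simps)
  qed
qed

section \<open>Jet coordinates and functions on the box\<close>

lemma finite_dvars [simp]: "finite (dvars n)"
  by (simp add: dvars_def)

lemma DepY_in_dvars [simp]: "DepY \<in> dvars n"
  by (simp add: dvars_def)

lemma Coef_in_dvars [simp]: "Coef k \<in> dvars n \<longleftrightarrow> k < n - 1"
  by (auto simp: dvars_def)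

lemma sum_dvars: "(\<Sum>v\<in>dvars n. g v) = g DepY + (\<Sum>k<n - 1. g (Coef k))"
  unfolding dvars_def by (subst sum.insert) (auto simp: sum.reindex inj_on_def)

lemma Indep_in_jcoords [simp]: "Indep \<in> jcoords n m"
  by (simp add: jcoords_def)

lemma Jet_in_jcoords [simp]: "Jet v j \<in> jcoords n m \<longleftrightarrow> v \<in> dvars n \<and> j \<le> m"
  by (auto simp: jcoords_def)

lemma jcoords_mono: "l \<le> m \<Longrightarrow> jcoords n l \<subseteq> jcoords n m"
  by (auto simp: jcoords_def)

lemma pd_eqI:
  "((\<lambda>t. F (p(i := t))) has_real_derivative D) (at (p i)) \<Longrightarrow> pd i F p = D"
  by (simp add: pd_def DERIV_imp_deriv)

lemma pd_const [simp]: "pd i (\<lambda>_. c) p = 0"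
  by (rule pd_eqI) auto

lemma base_upd_in: "i \<in> jcoords n 0 \<Longrightarrow> base n (p(i := t)) = (base n p)(i := t)"
  by (auto simp: base_def fun_eq_iff)

lemma base_upd_out: "i \<notin> jcoords n 0 \<Longrightarrow> base n (p(i := t)) = base n p"
  by (auto simp: base_def fun_eq_iff)

lemma base_apply [simp]: "i \<in> jcoords n 0 \<Longrightarrow> base n p i = p i"
  by (simp add: base_def)

lemma base_base [simp]: "base n (base n p) = base n p"
  by (simp add: base_def)

lemma pd_base:
  assumes "i \<in> jcoords n 0"
  shows "pd i (\<lambda>p. g (base n p)) p = pd i g (base n p)"
  using assms by (simp add: pd_def base_upd_in)

lemma smooth_base_pd:
  assumes "smooth_base n B F" "i \<in> jcoords n 0"
  shows "smooth_base n B (pd i F)"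
  unfolding smooth_base_def
proof (intro allI impI)
  fix js assume "set js \<subseteq> jcoords n 0"
  then show "continuous_on (base_space n B) (foldr pd js (pd i F)) \<and>
        (\<forall>i'\<in>jcoords n 0. \<forall>p\<in>base_space n B.
           (\<lambda>t. foldr pd js (pd i F) (p(i' := t))) differentiable (at (p i')))"
    using assms(1)[unfolded smooth_base_def, rule_format, of "js @ [i]"] assms(2) by auto
qed

lemma smooth_base_has_pd:
  assumes "smooth_base n B F" "i \<in> jcoords n 0" "p \<in> base_space n B"
  shows "((\<lambda>t. F (p(i := t))) has_real_derivative pd i F p) (at (p i))"
  using assms(1)[unfolded smooth_base_def, rule_format, of "[]"] assms(2,3)
  by (auto simp: pd_def DERIV_deriv_iff_real_differentiable)

text \<open>The jets whose base point lies in the box. Dropping the extensionality demanded of elements of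
  a jet space makes one region serve for jets of all orders.\<close>

definition jet_region :: "nat \<Rightarrow> (jcoord \<Rightarrow> real set) \<Rightarrow> jet set" where
  "jet_region n B = {p. \<forall>i\<in>jcoords n 0. p i \<in> B i}"

definition y_coords :: "nat \<Rightarrow> jcoord set" where
  "y_coords m = insert Indep (Jet DepY ` {..m})"

lemma Indep_in_y_coords [simp]: "Indep \<in> y_coords m"
  by (simp add: y_coords_def)

lemma Jet_in_y_coords [simp]: "Jet v j \<in> y_coords m \<longleftrightarrow> v = DepY \<and> j \<le> m"
  by (auto simp: y_coords_def)

lemma mono_y_coords: "mono y_coords"
  by (rule monoI) (auto simp: y_coords_def)

locale jet_box =
  fixes n :: nat and B :: "jcoord \<Rightarrow> real set"
  assumes order_ge_2: "n \<ge> 2"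
    and sides: "\<And>i. i \<in> jcoords n 0 \<Longrightarrow> open (B i) \<and> is_interval (B i) \<and> B i \<noteq> {}"
begin

abbreviation R :: "jet set" where "R \<equiv> jet_region n B"

lemma open_side: "i \<in> jcoords n 0 \<Longrightarrow> open (B i)"
  using sides by blast

lemma jet_regionD: "p \<in> R \<Longrightarrow> i \<in> jcoords n 0 \<Longrightarrow> p i \<in> B i"
  by (simp add: jet_region_def)

lemma base_space_alt: "p \<in> base_space n B \<longleftrightarrow> p \<in> R \<and> base n p = p"
  by (auto simp: jet_space_def PiE_iff jet_region_def base_def extensional_def restrict_def fun_eq_iff)

lemma base_in: "p \<in> R \<Longrightarrow> base n p \<in> base_space n B"
  unfolding base_space_alt by (auto simp: jet_region_def)

lemma base_space_nonempty: "\<exists>p. p \<in> base_space n B"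
proof -
  have "(\<lambda>i. SOME t. t \<in> B i) \<in> R"
    using sides by (auto simp: jet_region_def some_in_eq)
  then show ?thesis using base_in by blast
qed

lemma upd_in_region: "p \<in> R \<Longrightarrow> (i \<in> jcoords n 0 \<Longrightarrow> t \<in> B i) \<Longrightarrow> p(i := t) \<in> R"
  by (auto simp: jet_region_def)

lemma eventually_upd_in_region: "p \<in> R \<Longrightarrow> \<forall>\<^sub>F t in nhds (p i). p(i := t) \<in> R"
proof (cases "i \<in> jcoords n 0")
  case True
  assume "p \<in> R"
  then show ?thesis
    using True open_side[OF True]
    by (intro eventually_nhds[THEN iffD2] exI[of _ "B i"]) (auto simp: jet_region_def)
qed (auto simp: jet_region_def intro!: always_eventually)

lemma pd_cong:
  assumes "p \<in> R" "\<And>q. q \<in> R \<Longrightarrow> F q = G q"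
  shows "pd i F p = pd i G p"
  unfolding pd_def
  by (rule deriv_cong_ev, rule eventually_mono[OF eventually_upd_in_region[OF assms(1)]])
    (use assms in auto)

text \<open>Coordinates along which the derivative vanishes can be changed one after the other, each of
  them inside its interval, without leaving the box.\<close>

lemma base_cong_const:
  assumes S: "finite S" "S \<subseteq> jcoords n 0"
    and F: "\<And>p i. p \<in> base_space n B \<Longrightarrow> i \<in> S \<Longrightarrow>
      ((\<lambda>t. F (p(i := t))) has_real_derivative 0) (at (p i))"
    and p: "p \<in> base_space n B" and q: "q \<in> base_space n B"
    and pq: "\<And>i. i \<in> jcoords n 0 - S \<Longrightarrow> p i = q i"
  shows "F p = F q"
  using S F p pq
proof (induction S arbitrary: p rule: finite_induct)
  case empty
  then have "p = q"
    using q by (metis Diff_empty base_def base_space_alt restrict_ext)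
  then show ?case by simp
next
  case (insert i S)
  have i: "i \<in> jcoords n 0" using insert.prems by auto
  have upd: "p(i := t) \<in> base_space n B" if "t \<in> B i" for t
    using that insert.prems(3) upd_in_region[of p i t] i
    by (auto simp: base_space_alt base_upd_in)
  have pB: "p i \<in> B i" "q i \<in> B i"
    using insert.prems(3) q i by (auto simp: base_space_alt jet_regionD)
  have "\<exists>c. \<forall>t\<in>B i. F (p(i := t)) = c"
  proof (rule has_field_derivative_zero_constant)
    show "convex (B i)" using sides[OF i] is_interval_convex by blast
    show "((\<lambda>t. F (p(i := t))) has_real_derivative 0) (at t within B i)" if "t \<in> B i" for t
      using insert.prems(2)[OF upd[OF that] insertI1] unfolding fun_upd_upd fun_upd_same
      by (rule has_field_derivative_at_within)
  qed
  then have "F p = F (p(i := q i))" using pB by (metis fun_upd_triv)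
  also have "\<dots> = F q"
    using insert.prems pB by (intro insert.IH upd) auto
  finally show ?case .
qed


section \<open>Dependence on coordinates and affine top terms\<close>

text \<open>Relative to the region over the box, because the components of a field are unconstrained
  outside it.\<close>

definition depends_on :: "jcoord set \<Rightarrow> (jet \<Rightarrow> real) \<Rightarrow> bool" where
  "depends_on K F \<longleftrightarrow> (\<forall>p\<in>R. \<forall>q\<in>R. (\<forall>i\<in>K. p i = q i) \<longrightarrow> F p = F q)"

lemma depends_onD: "depends_on K F \<Longrightarrow> p \<in> R \<Longrightarrow> q \<in> R \<Longrightarrow> (\<And>i. i \<in> K \<Longrightarrow> p i = q i) \<Longrightarrow> F p = F q"
  unfolding depends_on_def by blast

lemma depends_on_upd: "depends_on K F \<Longrightarrow> p \<in> R \<Longrightarrow> p(i := t) \<in> R \<Longrightarrow> i \<notin> K \<Longrightarrow> F (p(i := t)) = F p"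
  by (rule depends_onD[of K F "p(i := t)" p]) auto

lemma depends_on_mono: "depends_on K F \<Longrightarrow> K \<subseteq> L \<Longrightarrow> depends_on L F"
  unfolding depends_on_def by (meson subsetD)

lemma pd_notin:
  assumes "depends_on K F" "i \<notin> K" "p \<in> R"
  shows "pd i F p = 0"
proof -
  have "pd i F p = deriv (\<lambda>t. F p) (p i)"
    unfolding pd_def
    by (rule deriv_cong_ev[OF eventually_mono[OF eventually_upd_in_region[OF assms(3)]]])
      (rule depends_on_upd[OF assms(1,3) _ assms(2)], auto)
  then show ?thesis by simp
qed

lemma depends_on_pd:
  assumes "depends_on K F"
  shows "depends_on K (pd i F)"
  unfolding depends_on_def
proof (intro ballI impI)
  fix p q assume pq: "p \<in> R" "q \<in> R" "\<forall>i\<in>K. p i = q i"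
  show "pd i F p = pd i F q"
  proof (cases "i \<in> K")
    case True
    have "\<forall>\<^sub>F t in nhds (p i). p(i := t) \<in> R \<and> q(i := t) \<in> R"
      using eventually_upd_in_region[OF pq(1), of i] eventually_upd_in_region[OF pq(2), of i]
        bspec[OF pq(3) True] by (simp add: eventually_conj_iff)
    then show ?thesis
      unfolding pd_def
    proof (rule deriv_cong_ev[OF eventually_mono])
      show "F (p(i := t)) = F (q(i := t))" if "p(i := t) \<in> R \<and> q(i := t) \<in> R" for t
        by (rule depends_onD[OF assms]) (use that pq(3) in auto)
    qed (use bspec[OF pq(3) True] in auto)
  next
    case False
    then show ?thesis using pd_notin[OF assms False] pq by simp
  qed
qed

lemma depends_on_total_deriv:
  assumes F: "depends_on K F" and "K \<subseteq> L"
    and shift: "\<And>v j. Jet v j \<in> K \<Longrightarrow> Jet v (Suc j) \<in> L"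
  shows "depends_on L (total_deriv n m F)"
  unfolding depends_on_def
proof (intro ballI impI)
  fix p q assume pq: "p \<in> R" "q \<in> R" "\<forall>i\<in>L. p i = q i"
  have pd: "pd i F p = pd i F q" for i
    by (rule depends_onD[OF depends_on_pd[OF F] pq(1,2)]) (use pq(3) assms(2) in auto)
  have "p (Jet v (Suc j)) * pd (Jet v j) F p = q (Jet v (Suc j)) * pd (Jet v j) F q" for v j
  proof (cases "Jet v j \<in> K")
    case True
    then have "p (Jet v (Suc j)) = q (Jet v (Suc j))" using pq(3) shift by blast
    then show ?thesis by (simp only: pd)
  next
    case False
    then show ?thesis using pd_notin[OF F False] pq by simp
  qed
  then show "total_deriv n m F p = total_deriv n m F q"
    by (simp only: total_deriv_def pd)
qed

text \<open>Stated for a family \<open>K\<close> so that it serves twice: with all jet coordinates of order at most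
  \<open>j\<close>, which is automatic, and with \<open>x\<close> and the derivatives of \<open>y\<close> alone, once \<open>\<xi>\<close> and
  \<open>\<eta>\<close> are known not to depend on the coefficients.\<close>

lemma depends_on_prolong_coeff:
  assumes K: "mono K" "\<And>w i j. Jet w i \<in> K j \<Longrightarrow> Jet w (Suc i) \<in> K (Suc j)" "Jet v 0 \<in> K 0"
    and "depends_on (K 0) (\<lambda>p. \<xi> (base n p))" "depends_on (K 0) (\<lambda>p. \<phi> v (base n p))"
  shows "depends_on (K j) (prolong_coeff n \<xi> \<phi> v j)"
proof (induction j)
  case (Suc j)
  have top: "Jet v j \<in> K j" for j
    by (induction j) (simp_all add: K)
  have "depends_on (K (Suc j)) (total_deriv n j (prolong_coeff n \<xi> \<phi> v j))"
    by (rule depends_on_total_deriv[OF Suc.IH]) (simp_all add: K monoD[OF K(1)])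
  moreover have "depends_on (K (Suc j)) (total_deriv n 0 (\<lambda>p. \<xi> (base n p)))"
  proof (rule depends_on_mono)
    show "depends_on (K 1) (total_deriv n 0 (\<lambda>p. \<xi> (base n p)))"
      by (rule depends_on_total_deriv[OF assms(4)]) (simp_all add: K monoD[OF K(1)])
    show "K 1 \<subseteq> K (Suc j)" by (simp add: monoD[OF K(1)])
  qed
  ultimately have "total_deriv n j (prolong_coeff n \<xi> \<phi> v j) p - p (Jet v (Suc j)) * total_deriv n 0 (\<lambda>p. \<xi> (base n p)) p =
      total_deriv n j (prolong_coeff n \<xi> \<phi> v j) q - q (Jet v (Suc j)) * total_deriv n 0 (\<lambda>p. \<xi> (base n p)) q"
    if "p \<in> R" "q \<in> R" "\<forall>i\<in>K (Suc j). p i = q i" for p q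
    using that bspec[OF that(3) top] by (intro arg_cong2[of _ _ _ _ "(-)"] arg_cong2[of _ _ _ _ "(*)"]) (blast dest: depends_onD)+
  then show ?case
    unfolding depends_on_def prolong_coeff.simps by blast
qed (simp add: assms)

lemma depends_on_base: "depends_on (jcoords n 0) (\<lambda>p. g (base n p))"
  by (auto simp: depends_on_def base_def intro!: arg_cong[of _ _ g] restrict_ext)

lemma depends_on_jcoords_prolong:
  assumes "v \<in> dvars n"
  shows "depends_on (jcoords n j) (prolong_coeff n \<xi> \<phi> v j)"
proof (rule depends_on_prolong_coeff[of "jcoords n"])
  show "mono (jcoords n)" by (rule monoI) (rule jcoords_mono)
  show "depends_on (jcoords n 0) (\<lambda>p. \<xi> (base n p))" "depends_on (jcoords n 0) (\<lambda>p. \<phi> v (base n p))"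
    by (fact depends_on_base)+
qed (use assms in simp_all)

text \<open>A new top coordinate occurs in a total derivative only as the factor of one partial
  derivative. It is thus exactly affine in it, with that partial derivative as slope.\<close>

lemma total_deriv_upd_top:
  assumes F: "depends_on (jcoords n m) F" and p: "p \<in> R" and v: "v \<in> dvars n"
  shows "total_deriv n m F (p(Jet v (Suc m) := t)) =
    total_deriv n m F p + (t - p (Jet v (Suc m))) * pd (Jet v m) F p"
proof -
  let ?q = "p(Jet v (Suc m) := t)"
  have "?q \<in> R" using p by (intro upd_in_region) auto
  then have pd: "pd i F ?q = pd i F p" for i
    by (intro depends_on_upd[OF depends_on_pd[OF F] p]) auto
  have "(\<Sum>w\<in>dvars n. \<Sum>j\<le>m. ?q (Jet w (Suc j)) * pd (Jet w j) F ?q) =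
    (\<Sum>w\<in>dvars n. \<Sum>j\<le>m. p (Jet w (Suc j)) * pd (Jet w j) F p +
      (if w = v then if j = m then (t - p (Jet v (Suc m))) * pd (Jet v m) F p else 0 else 0))"
    by (intro sum.cong refl) (auto simp: pd algebra_simps)
  also have "\<dots> = (\<Sum>w\<in>dvars n. \<Sum>j\<le>m. p (Jet w (Suc j)) * pd (Jet w j) F p)
      + (\<Sum>w\<in>dvars n. if w = v then (t - p (Jet v (Suc m))) * pd (Jet v m) F p else 0)"
    unfolding sum.distrib by (intro arg_cong2[of _ _ _ _ "(+)"] sum.cong refl) auto
  finally show ?thesis
    using v by (simp add: total_deriv_def pd)
qed

lemma pd_affine:
  assumes "\<And>t. F (p(i := t)) = F p + (t - p i) * D"
  shows "pd i F p = D"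
  by (rule pd_eqI) (auto simp: assms intro!: derivative_eq_intros)

abbreviation prolong_y :: "(jet \<Rightarrow> real) \<Rightarrow> (dvar \<Rightarrow> jet \<Rightarrow> real) \<Rightarrow> nat \<Rightarrow> jet \<Rightarrow> real" where
  "prolong_y \<xi> \<phi> \<equiv> prolong_coeff n \<xi> \<phi> DepY"

abbreviation tderiv :: "(jet \<Rightarrow> real) \<Rightarrow> jet \<Rightarrow> real" where
  "tderiv \<xi> \<equiv> total_deriv n 0 (\<lambda>q. \<xi> (base n q))"

lemma tderiv_upd_high:
  assumes "p \<in> R" "j \<ge> 2"
  shows "tderiv \<xi> (p(Jet v j := t)) = tderiv \<xi> p"
proof (rule depends_on_upd[of "jcoords n 1"])
  show "depends_on (jcoords n 1) (tderiv \<xi>)"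
    by (rule depends_on_total_deriv[OF depends_on_base]) (use jcoords_mono in auto)
  show "p(Jet v j := t) \<in> R" using assms by (intro upd_in_region) auto
qed (use assms in auto)

lemma prolong_y_1: "prolong_y \<xi> \<phi> 1 p = tderiv (\<phi> DepY) p - p (Jet DepY 1) * tderiv \<xi> p"
  by simp

text \<open>The slope of a prolongation coefficient in its top coordinates is passed on from one order to
  the next by \<open>total_deriv_upd_top\<close>.\<close>

lemma prolong_y_upd_Coef_top:
  assumes "1 \<le> j" "p \<in> R" "k < n - 1"
  shows "prolong_y \<xi> \<phi> j (p(Jet (Coef k) j := t)) = prolong_y \<xi> \<phi> j p +
    (t - p (Jet (Coef k) j)) * (pd (Jet (Coef k) 0) (\<phi> DepY) (base n p)
      - p (Jet DepY 1) * pd (Jet (Coef k) 0) \<xi> (base n p))"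
  using assms(1,2)
proof (induction j arbitrary: p t rule: nat_induct_at_least)
  case base
  let ?q = "p(Jet (Coef k) 1 := t)"
  have upd: "tderiv g ?q = tderiv g p + (t - p (Jet (Coef k) 1)) * pd (Jet (Coef k) 0) g (base n p)" for g
    using total_deriv_upd_top[OF depends_on_base[of g] base, where v = "Coef k" and t = t] assms(3)
    by (simp add: pd_base)
  show ?case
    unfolding prolong_y_1 upd by (simp add: algebra_simps)
next
  case (Suc j)
  let ?i = "Jet (Coef k) j"
  have p: "p(?i := t) \<in> R" for t
    using Suc by (intro upd_in_region) auto
  have pd: "pd ?i (prolong_y \<xi> \<phi> j) p = pd (Jet (Coef k) 0) (\<phi> DepY) (base n p)
      - p (Jet DepY 1) * pd (Jet (Coef k) 0) \<xi> (base n p)"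
    by (rule pd_affine) (rule Suc.IH[OF Suc.prems])
  have top: "total_deriv n j (prolong_y \<xi> \<phi> j) (p(Jet (Coef k) (Suc j) := t)) = total_deriv n j (prolong_y \<xi> \<phi> j) p
      + (t - p (Jet (Coef k) (Suc j))) * pd ?i (prolong_y \<xi> \<phi> j) p"
    by (rule total_deriv_upd_top[OF depends_on_jcoords_prolong \<open>p \<in> R\<close>]) (use assms in auto)
  have low: "tderiv \<xi> (p(Jet (Coef k) (Suc j) := t)) = tderiv \<xi> p"
    by (rule tderiv_upd_high[OF \<open>p \<in> R\<close>]) (use Suc.hyps in simp)
  show ?case
    unfolding prolong_coeff.simps(2) top low pd by (simp add: algebra_simps)
qed

text \<open>In the direction of \<open>y\<close> every order subtracts one more \<open>D \<xi>\<close>. The induction starts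
  at order 2 because the coefficient of order 1 is quadratic in \<open>y'\<close>.\<close>

lemma prolong_y_upd_DepY_top:
  assumes "2 \<le> j" "p \<in> R"
  shows "prolong_y \<xi> \<phi> j (p(Jet DepY j := t)) = prolong_y \<xi> \<phi> j p +
    (t - p (Jet DepY j)) * (pd (Jet DepY 0) (\<phi> DepY) (base n p)
      - p (Jet DepY 1) * pd (Jet DepY 0) \<xi> (base n p) - real j * tderiv \<xi> p)"
  using assms
proof (induction j arbitrary: p t rule: nat_induct_at_least)
  case base
  let ?i = "Jet DepY 1"
  have q: "prolong_y \<xi> \<phi> 1 (p(?i := t)) = tderiv (\<phi> DepY) p
      + (t - p ?i) * pd (Jet DepY 0) (\<phi> DepY) (base n p)
      - t * (tderiv \<xi> p + (t - p ?i) * pd (Jet DepY 0) \<xi> (base n p))" for t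
    using total_deriv_upd_top[OF depends_on_base[of "\<phi> DepY"] base, where v = DepY and t = t]
      total_deriv_upd_top[OF depends_on_base[of \<xi>] base, where v = DepY and t = t]
    by (simp add: pd_base)
  have pd: "pd ?i (prolong_y \<xi> \<phi> 1) p = pd (Jet DepY 0) (\<phi> DepY) (base n p)
      - tderiv \<xi> p - p ?i * pd (Jet DepY 0) \<xi> (base n p)"
    by (rule pd_eqI) (unfold q, auto intro!: derivative_eq_intros simp: algebra_simps)
  have "prolong_y \<xi> \<phi> 2 r = total_deriv n 1 (prolong_y \<xi> \<phi> 1) r - r (Jet DepY 2) * tderiv \<xi> r" for r
    by (simp only: numeral_2_eq_2 prolong_coeff.simps(2) One_nat_def)
  moreover have "total_deriv n 1 (prolong_y \<xi> \<phi> 1) (p(Jet DepY 2 := t)) =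
      total_deriv n 1 (prolong_y \<xi> \<phi> 1) p + (t - p (Jet DepY 2)) * pd ?i (prolong_y \<xi> \<phi> 1) p"
    using total_deriv_upd_top[OF depends_on_jcoords_prolong[of DepY 1 \<xi> \<phi>] base, where v = DepY and t = t]
    by (simp only: DepY_in_dvars simp_thms One_nat_def numeral_2_eq_2)
  ultimately show ?case
    by (simp only: pd tderiv_upd_high[OF base order_refl] fun_upd_same of_nat_numeral) (simp add: algebra_simps)
next
  case (Suc j)
  let ?i = "Jet DepY j"
  have pd: "pd ?i (prolong_y \<xi> \<phi> j) p = pd (Jet DepY 0) (\<phi> DepY) (base n p)
      - p (Jet DepY 1) * pd (Jet DepY 0) \<xi> (base n p) - real j * tderiv \<xi> p"
    by (rule pd_affine) (rule Suc.IH[OF Suc.prems])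
  have top: "total_deriv n j (prolong_y \<xi> \<phi> j) (p(Jet DepY (Suc j) := t)) = total_deriv n j (prolong_y \<xi> \<phi> j) p
      + (t - p (Jet DepY (Suc j))) * pd ?i (prolong_y \<xi> \<phi> j) p"
    by (rule total_deriv_upd_top[OF depends_on_jcoords_prolong \<open>p \<in> R\<close>]) (use assms in auto)
  have low: "tderiv \<xi> (p(Jet DepY (Suc j) := t)) = tderiv \<xi> p"
    by (rule tderiv_upd_high[OF \<open>p \<in> R\<close>]) (use Suc.hyps in simp)
  show ?case
    unfolding prolong_coeff.simps(2) top low pd by (simp add: algebra_simps)
qed

section \<open>The symmetry condition\<close>

lemma pd_Delta:
  "pd i (Delta n) p = of_bool (i = Jet DepY n)
     + (\<Sum>k<n - 1. of_bool (i = Jet (Coef k) 0) * p (Jet DepY k)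
          + p (Jet (Coef k) 0) * of_bool (i = Jet DepY k))"
proof (rule pd_eqI)
  have coord: "((\<lambda>t. (p(i := t)) c) has_real_derivative of_bool (i = c)) (at s)" for c s
    by (cases "i = c") (auto intro!: derivative_eq_intros)
  show "((\<lambda>t. Delta n (p(i := t))) has_real_derivative of_bool (i = Jet DepY n)
     + (\<Sum>k<n - 1. of_bool (i = Jet (Coef k) 0) * p (Jet DepY k)
          + p (Jet (Coef k) 0) * of_bool (i = Jet DepY k))) (at (p i))"
    unfolding Delta_def
    by (intro DERIV_add DERIV_sum)
      (use DERIV_mult[OF coord[of _ "p i"] coord[of _ "p i"]] coord in \<open>auto simp: mult.commute add.commute\<close>)
qed

lemma prolongation_Delta:
  "prolongation n n \<xi> \<phi> (Delta n) p =
     prolong_y \<xi> \<phi> n p + (\<Sum>k<n - 1. p (Jet (Coef k) 0) * prolong_y \<xi> \<phi> k p)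
     + (\<Sum>k<n - 1. \<phi> (Coef k) (base n p) * p (Jet DepY k))"
proof -
  have Y: "pd (Jet DepY j) (Delta n) p =
    (if j = n then 1 else 0) + (if j < n - 1 then p (Jet (Coef j) 0) else 0)" for j
    by (auto simp: pd_Delta)
  have C: "pd (Jet (Coef k) j) (Delta n) p = (if j = 0 then p (Jet DepY k) else 0)" if "k < n - 1" for j k
    using that by (auto simp: pd_Delta)
  have "(\<Sum>j\<le>n. prolong_y \<xi> \<phi> j p * pd (Jet DepY j) (Delta n) p) =
    (\<Sum>j\<le>n. if j = n then prolong_y \<xi> \<phi> n p else 0)
    + (\<Sum>j\<le>n. if j < n - 1 then p (Jet (Coef j) 0) * prolong_y \<xi> \<phi> j p else 0)"
    unfolding sum.distrib[symmetric] Y by (intro sum.cong) (auto simp: algebra_simps)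
  also have "(\<Sum>j\<le>n. if j < n - 1 then p (Jet (Coef j) 0) * prolong_y \<xi> \<phi> j p else 0) =
     (\<Sum>j<n - 1. p (Jet (Coef j) 0) * prolong_y \<xi> \<phi> j p)"
    by (intro sum.mono_neutral_cong_right) auto
  finally have y: "(\<Sum>j\<le>n. prolong_y \<xi> \<phi> j p * pd (Jet DepY j) (Delta n) p) =
    prolong_y \<xi> \<phi> n p + (\<Sum>j<n - 1. p (Jet (Coef j) 0) * prolong_y \<xi> \<phi> j p)"
    by simp
  have c: "(\<Sum>j\<le>n. prolong_coeff n \<xi> \<phi> (Coef k) j p * pd (Jet (Coef k) j) (Delta n) p) =
    \<phi> (Coef k) (base n p) * p (Jet DepY k)" if "k < n - 1" for k
  proof -
    have "(\<Sum>j\<le>n. prolong_coeff n \<xi> \<phi> (Coef k) j p * pd (Jet (Coef k) j) (Delta n) p) =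
      (\<Sum>j\<le>n. if j = 0 then \<phi> (Coef k) (base n p) * p (Jet DepY k) else 0)"
      by (intro sum.cong) (auto simp: C[OF that])
    then show ?thesis by simp
  qed
  have "pd Indep (Delta n) p = 0" by (simp add: pd_Delta)
  then show ?thesis
    unfolding prolongation_def sum_dvars by (simp add: y c)
qed

lemma generator_GS_alt:
  "generator_GS n B \<xi> \<phi> \<longleftrightarrow>
     smooth_base n B \<xi> \<and> (\<forall>v\<in>dvars n. smooth_base n B (\<phi> v)) \<and>
     (\<forall>p\<in>R. Delta n p = 0 \<longrightarrow>
        prolong_y \<xi> \<phi> n p + (\<Sum>k<n - 1. p (Jet (Coef k) 0) * prolong_y \<xi> \<phi> k p)
        + (\<Sum>k<n - 1. \<phi> (Coef k) (base n p) * p (Jet DepY k)) = 0)"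
proof -
  let ?G = "prolongation n n \<xi> \<phi> (Delta n)"
  have jet: "p \<in> R" if "p \<in> jet_space n n B" for p
    using that by (auto simp: jet_space_def jet_region_def PiE_iff Ball_def jcoords_def split: if_splits)
  have restr: "restrict p (jcoords n n) \<in> jet_space n n B" "Delta n (restrict p (jcoords n n)) = Delta n p"
    "?G (restrict p (jcoords n n)) = ?G p" if p: "p \<in> R" for p
  proof -
    let ?q = "restrict p (jcoords n n)"
    show "?q \<in> jet_space n n B"
      using p by (auto simp: jet_space_def jet_region_def PiE_iff)
    have "?q \<in> R" using p jcoords_mono[of 0 n n] by (auto simp: jet_region_def)
    then have "prolong_y \<xi> \<phi> k ?q = prolong_y \<xi> \<phi> k p" if "k \<le> n" for k
      by (rule depends_onD[OF depends_on_jcoords_prolong[OF DepY_in_dvars] _ p])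
        (use jcoords_mono[OF that, of n] in auto)
    moreover have "base n ?q = base n p"
      using jcoords_mono[of 0 n n] by (auto simp: base_def fun_eq_iff restrict_def)
    ultimately show "?G ?q = ?G p"
      using order_ge_2 unfolding prolongation_Delta
      by (intro arg_cong2[of _ _ _ _ "(+)"] sum.cong) auto
    show "Delta n ?q = Delta n p"
      unfolding Delta_def by (intro arg_cong2[of _ _ _ _ "(+)"] sum.cong) auto
  qed
  have "(\<forall>p\<in>jet_space n n B. Delta n p = 0 \<longrightarrow> ?G p = 0) \<longleftrightarrow> (\<forall>p\<in>R. Delta n p = 0 \<longrightarrow> ?G p = 0)"
    using jet restr by metis
  then show ?thesis unfolding generator_GS_def prolongation_Delta by blast
qed

text \<open>Solving \<open>\<Delta> = 0\<close> for \<open>y\<^sup>(\<^sup>n\<^sup>)\<close> turns the symmetry condition into an identity that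
  holds for all jets over the box. Among the \<open>\<eta>\<^sub>k\<close> only \<open>\<eta>\<^sub>n\<close> changes under the substitution,
  by its slope times \<open>\<Delta>\<close>.\<close>

lemma reduced_symmetry_condition:
  assumes gen: "generator_GS n B \<xi> \<phi>" and p: "p \<in> R"
  shows "prolong_y \<xi> \<phi> n p
     - Delta n p * (pd (Jet DepY 0) (\<phi> DepY) (base n p)
         - p (Jet DepY 1) * pd (Jet DepY 0) \<xi> (base n p) - real n * tderiv \<xi> p)
     + (\<Sum>k<n - 1. p (Jet (Coef k) 0) * prolong_y \<xi> \<phi> k p)
     + (\<Sum>k<n - 1. \<phi> (Coef k) (base n p) * p (Jet DepY k)) = 0"
proof -
  let ?q = "p(Jet DepY n := p (Jet DepY n) - Delta n p)"
  have q: "?q \<in> R" using p order_ge_2 by (intro upd_in_region) auto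
  have "(\<Sum>k<n - 1. ?q (Jet (Coef k) 0) * ?q (Jet DepY k)) = (\<Sum>k<n - 1. p (Jet (Coef k) 0) * p (Jet DepY k))"
    by (intro sum.cong) auto
  then have "Delta n ?q = 0" unfolding Delta_def by simp
  moreover have "prolong_y \<xi> \<phi> k ?q = prolong_y \<xi> \<phi> k p" if "k < n" for k
    using that depends_on_upd[OF depends_on_jcoords_prolong[OF DepY_in_dvars] p q] by auto
  moreover have "base n ?q = base n p"
    using order_ge_2 by (intro base_upd_out) auto
  ultimately have "prolong_y \<xi> \<phi> n ?q + (\<Sum>k<n - 1. p (Jet (Coef k) 0) * prolong_y \<xi> \<phi> k p)
     + (\<Sum>k<n - 1. \<phi> (Coef k) (base n p) * p (Jet DepY k)) = 0"
  proof -
    assume *: "\<And>k. k < n \<Longrightarrow> prolong_y \<xi> \<phi> k ?q = prolong_y \<xi> \<phi> k p" "base n ?q = base n p" "Delta n ?q = 0"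
    have sums: "(\<Sum>k<n - 1. ?q (Jet (Coef k) 0) * prolong_y \<xi> \<phi> k ?q) = (\<Sum>k<n - 1. p (Jet (Coef k) 0) * prolong_y \<xi> \<phi> k p)"
      "(\<Sum>k<n - 1. \<phi> (Coef k) (base n ?q) * ?q (Jet DepY k)) = (\<Sum>k<n - 1. \<phi> (Coef k) (base n p) * p (Jet DepY k))"
      unfolding *(2) by (intro sum.cong refl; simp add: *(1))+
    have "Delta n ?q = 0 \<longrightarrow> prolong_y \<xi> \<phi> n ?q
        + (\<Sum>k<n - 1. ?q (Jet (Coef k) 0) * prolong_y \<xi> \<phi> k ?q)
        + (\<Sum>k<n - 1. \<phi> (Coef k) (base n ?q) * ?q (Jet DepY k)) = 0"
      using gen q unfolding generator_GS_alt by blast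
    then show ?thesis
      unfolding sums using *(3) by (rule mp)
  qed
  then show ?thesis
    unfolding prolong_y_upd_DepY_top[OF order_ge_2 p] by (simp add: algebra_simps)
qed


lemma base_upd:
  assumes "p \<in> base_space n B" "i \<in> jcoords n 0" "t \<in> B i"
  shows "p(i := t) \<in> base_space n B"
  using assms upd_in_region[of p i t] by (auto simp: base_space_alt base_upd_in)

lemma smooth_base_region_has_pd:
  assumes "smooth_base n B g" "i \<in> jcoords n 0" "p \<in> R"
  shows "((\<lambda>t. g (base n (p(i := t)))) has_real_derivative pd i g (base n p)) (at (p i))"
  using smooth_base_has_pd[OF assms(1,2) base_in[OF assms(3)]] assms(2) by (simp add: base_upd_in)

lemma depends_on_pd_base:
  assumes "depends_on K (\<lambda>p. g (base n p))" "i \<in> jcoords n 0"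
  shows "depends_on K (\<lambda>p. pd i g (base n p))"
proof -
  have "pd i (\<lambda>p. g (base n p)) = (\<lambda>p. pd i g (base n p))"
    by (rule ext) (rule pd_base[OF assms(2)])
  then show ?thesis using depends_on_pd[OF assms(1), of i] by simp
qed

lemma pd_base_notin:
  assumes "depends_on K (\<lambda>p. g (base n p))" "i \<in> jcoords n 0" "i \<notin> K" "b \<in> base_space n B"
  shows "pd i g b = 0"
  using pd_notin[OF assms(1,3), of b] assms(2,4) by (simp add: pd_base base_space_alt)

lemma depends_on_if_pd_0:
  assumes g: "smooth_base n B g" and S: "S \<subseteq> jcoords n 0" "finite S"
    and 0: "\<And>b i. b \<in> base_space n B \<Longrightarrow> i \<in> S \<Longrightarrow> pd i g b = 0"
  shows "depends_on (jcoords n 0 - S) (\<lambda>p. g (base n p))"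
  unfolding depends_on_def
proof (intro ballI impI)
  fix p q assume pq: "p \<in> R" "q \<in> R" "\<forall>i\<in>jcoords n 0 - S. p i = q i"
  show "g (base n p) = g (base n q)"
  proof (rule base_cong_const[where F = g, OF S(2,1)])
    show "((\<lambda>t. g (b(i := t))) has_real_derivative 0) (at (b i))"
      if "b \<in> base_space n B" "i \<in> S" for b i
      using smooth_base_has_pd[OF g _ that(1), of i] that S 0[OF that] by auto
    show "base n p i = base n q i" if "i \<in> jcoords n 0 - S" for i
      using bspec[OF pq(3) that] that by simp
  qed (use pq base_in in auto)
qed

lemma finite_jcoords: "finite (jcoords n 0)"
proof -
  have "jcoords n 0 = insert Indep ((\<lambda>v. Jet v 0) ` dvars n)"
    by (auto simp: jcoords_def)
  then show ?thesis by simp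
qed

lemma total_deriv_y:
  assumes "depends_on (y_coords m) F" "p \<in> R"
  shows "total_deriv n m F p = pd Indep F p + (\<Sum>j\<le>m. p (Jet DepY (Suc j)) * pd (Jet DepY j) F p)"
  using pd_notin[OF assms(1) _ assms(2)] by (simp add: total_deriv_def sum_dvars)

lemma prolong_y_Suc:
  assumes "depends_on (y_coords m) (prolong_y \<xi> \<phi> m)" "p \<in> R"
    and F: "\<And>q. q \<in> R \<Longrightarrow> prolong_y \<xi> \<phi> m q = F q"
  shows "prolong_y \<xi> \<phi> (Suc m) p = pd Indep F p
    + (\<Sum>j\<le>m. p (Jet DepY (Suc j)) * pd (Jet DepY j) F p) - p (Jet DepY (Suc m)) * tderiv \<xi> p"
proof -
  have "pd i (prolong_y \<xi> \<phi> m) p = pd i F p" for i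
    by (rule pd_cong[OF assms(2) F])
  then show ?thesis
    using total_deriv_y[OF assms(1,2)] by (simp only: prolong_coeff.simps(2))
qed

text \<open>Test jets over a base point, which already contains \<open>y\<close> itself: \<open>s\<close> prescribes its
  derivatives of orders from 1.\<close>

definition jet_over :: "jet \<Rightarrow> (nat \<Rightarrow> real) \<Rightarrow> jet" where
  "jet_over b s i = (case i of Indep \<Rightarrow> b Indep
     | Jet v j \<Rightarrow> if j = 0 then b (Jet v 0) else if v = DepY then s j else 0)"

lemma jet_over_simps [simp]:
  "jet_over b s Indep = b Indep"
  "jet_over b s (Jet v 0) = b (Jet v 0)"
  "0 < j \<Longrightarrow> jet_over b s (Jet DepY j) = s j"
  by (simp_all add: jet_over_def)

lemma jet_over_in: "i \<in> jcoords n 0 \<Longrightarrow> jet_over b s i = b i"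
  by (cases i) auto

lemma jet_over_region:
  assumes "b \<in> base_space n B"
  shows "jet_over b s \<in> R" "base n (jet_over b s) = b"
proof -
  have b: "b \<in> R" "base n b = b" using assms by (auto simp: base_space_alt)
  show "jet_over b s \<in> R"
    using b(1) by (simp add: jet_region_def jet_over_in)
  have "base n (jet_over b s) = base n b"
    unfolding base_def by (rule restrict_ext) (rule jet_over_in)
  then show "base n (jet_over b s) = b" using b(2) by simp
qed

end

section \<open>Restrictions on a symmetry\<close>

locale symmetry = jet_box +
  fixes \<xi> :: "jet \<Rightarrow> real" and \<phi> :: "dvar \<Rightarrow> jet \<Rightarrow> real"
  assumes gen: "generator_GS n B \<xi> \<phi>"
    and y_nonzero: "0 \<notin> B (Jet DepY 0)"
begin

abbreviation "\<eta> \<equiv> \<phi> DepY"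
abbreviation "Y \<equiv> Jet DepY 0"

abbreviation slope :: "jet \<Rightarrow> real" where
  "slope p \<equiv> pd Y \<eta> (base n p) - p (Jet DepY 1) * pd Y \<xi> (base n p) - real n * tderiv \<xi> p"

lemma smooth_xi: "smooth_base n B \<xi>" and smooth_eta: "smooth_base n B \<eta>"
  using gen by (auto simp: generator_GS_def)

lemma y_ne_0: "b \<in> base_space n B \<Longrightarrow> b Y \<noteq> 0"
  using y_nonzero jet_regionD[of b Y] by (auto simp: base_space_alt)

lemmas reduced = reduced_symmetry_condition[OF gen]

text \<open>The derivative \<open>c\<^sub>k\<^sup>(\<^sup>n\<^sup>)\<close> occurs in the symmetry condition only through \<open>\<eta>\<^sub>n\<close>, so
  the slope \<open>\<eta>\<^sub>c - y' \<xi>\<^sub>c\<close> of \<open>\<eta>\<^sub>n\<close> in it vanishes, and \<open>y'\<close> is free as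
  \<open>n \<ge> 2\<close>.\<close>

lemma pd_Coef_eq_0:
  assumes b: "b \<in> base_space n B" and k: "k < n - 1"
  shows "pd (Jet (Coef k) 0) \<xi> b = 0" "pd (Jet (Coef k) 0) \<eta> b = 0"
proof -
  have *: "pd (Jet (Coef k) 0) \<eta> b - s * pd (Jet (Coef k) 0) \<xi> b = 0" for s
  proof -
    define p where "p = jet_over b (\<lambda>_. s)"
    define q where "q = p(Jet (Coef k) n := p (Jet (Coef k) n) + 1)"
    have p: "p \<in> R" "base n p = b" using jet_over_region[OF b] by (auto simp: p_def)
    have q: "q \<in> R" unfolding q_def using order_ge_2 p by (intro upd_in_region) auto
    have bq: "base n q = base n p" unfolding q_def using order_ge_2 by (intro base_upd_out) auto
    have low: "prolong_y \<xi> \<phi> m q = prolong_y \<xi> \<phi> m p" if "m < n" for m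
      using that p(1) q unfolding q_def
      by (intro depends_on_upd[OF depends_on_jcoords_prolong[OF DepY_in_dvars]]) auto
    have td: "tderiv \<xi> q = tderiv \<xi> p"
      unfolding q_def by (rule tderiv_upd_high[OF p(1) order_ge_2])
    have same: "q (Jet DepY j) = p (Jet DepY j)" "q (Jet v 0) = p (Jet v 0)" for j v
      using order_ge_2 by (auto simp: q_def)
    have "Delta n q = Delta n p" by (simp only: Delta_def same)
    moreover have "(\<Sum>m<n - 1. q (Jet (Coef m) 0) * prolong_y \<xi> \<phi> m q) =
        (\<Sum>m<n - 1. p (Jet (Coef m) 0) * prolong_y \<xi> \<phi> m p)"
      by (intro sum.cong refl) (simp add: same low)
    ultimately have "prolong_y \<xi> \<phi> n q = prolong_y \<xi> \<phi> n p"
      using reduced[OF p(1)] reduced[OF q] by (simp only: same td bq)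
    moreover have "1 \<le> n" "p (Jet DepY 1) = s" using order_ge_2 by (simp_all add: p_def)
    ultimately show ?thesis
      using prolong_y_upd_Coef_top[of n p k \<xi> \<phi> "p (Jet (Coef k) n) + 1"] p k
      by (simp add: q_def[symmetric] p_def[symmetric])
  qed
  show "pd (Jet (Coef k) 0) \<xi> b = 0" "pd (Jet (Coef k) 0) \<eta> b = 0"
    using *[of 0] *[of 1] by simp_all
qed

lemma depends_on_if_Coef_free:
  assumes "smooth_base n B g" "\<And>b k. b \<in> base_space n B \<Longrightarrow> k < n - 1 \<Longrightarrow> pd (Jet (Coef k) 0) g b = 0"
  shows "depends_on (y_coords 0) (\<lambda>p. g (base n p))"
proof (rule depends_on_mono)
  let ?S = "(\<lambda>k. Jet (Coef k) 0) ` {..<n - 1}"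
  show "depends_on (jcoords n 0 - ?S) (\<lambda>p. g (base n p))"
    by (rule depends_on_if_pd_0[OF assms(1)]) (use assms(2) in auto)
  show "jcoords n 0 - ?S \<subseteq> y_coords 0"
    by (auto simp: jcoords_def dvars_def)
qed

lemmas Coef_free_xi = depends_on_if_Coef_free[OF smooth_xi pd_Coef_eq_0(1)]
lemmas Coef_free_eta = depends_on_if_Coef_free[OF smooth_eta pd_Coef_eq_0(2)]

lemma tderiv_y:
  assumes "depends_on (y_coords 0) (\<lambda>p. g (base n p))" "p \<in> R"
  shows "tderiv g p = pd Indep g (base n p) + p (Jet DepY 1) * pd Y g (base n p)"
  using total_deriv_y[OF assms] by (simp add: pd_base)

lemma depends_on_prolong_y: "depends_on (y_coords j) (prolong_y \<xi> \<phi> j)"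
proof (rule depends_on_prolong_coeff[of y_coords])
  show "mono y_coords" by (rule monoI) (auto simp: y_coords_def)
qed (simp_all add: Coef_free_xi Coef_free_eta)

text \<open>The components along the coefficients enter the symmetry condition linearly in the jet
  coordinates, whereas \<open>\<xi>\<close> and \<open>\<eta>\<close> do not depend on the coefficients. Comparing two values of
  one coefficient therefore isolates a prolongation coefficient of low order.\<close>

lemma coefficient_shift:
  assumes p: "p \<in> R" and k: "k < n - 1" and c: "c \<in> B (Jet (Coef k) 0)"
    and q: "q = p(Jet (Coef k) 0 := c)"
  shows "(c - p (Jet (Coef k) 0)) * (prolong_y \<xi> \<phi> k p - p (Jet DepY k) * slope p)
    + (\<Sum>m<n - 1. (\<phi> (Coef m) (base n q) - \<phi> (Coef m) (base n p)) * p (Jet DepY m)) = 0"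
proof -
  have qR: "q \<in> R" unfolding q using p c by (intro upd_in_region) auto
  have eq: "F q = F p" if "depends_on (y_coords j) F" for F j
    using depends_on_upd[OF that p, of "Jet (Coef k) 0" c] qR by (simp add: q)
  have y: "q (Jet DepY j) = p (Jet DepY j)" for j by (simp add: q)
  have sum: "(\<Sum>m<n - 1. q (Jet (Coef m) 0) * g m) =
      (\<Sum>m<n - 1. p (Jet (Coef m) 0) * g m) + (c - p (Jet (Coef k) 0)) * g k" for g
  proof -
    have "(\<Sum>m<n - 1. q (Jet (Coef m) 0) * g m) =
      (\<Sum>m<n - 1. p (Jet (Coef m) 0) * g m + (if m = k then (c - p (Jet (Coef k) 0)) * g k else 0))"
      by (intro sum.cong refl) (auto simp: q algebra_simps)
    then show ?thesis using k by (simp add: sum.distrib)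
  qed
  have D: "Delta n q = Delta n p + (c - p (Jet (Coef k) 0)) * p (Jet DepY k)"
    unfolding Delta_def y sum by simp
  have "depends_on (y_coords 1) (tderiv \<xi>)"
    by (rule depends_on_total_deriv[OF Coef_free_xi]) (auto simp: y_coords_def)
  then have td: "tderiv \<xi> q = tderiv \<xi> p" by (rule eq)
  have pd: "pd Y \<eta> (base n q) = pd Y \<eta> (base n p)" "pd Y \<xi> (base n q) = pd Y \<xi> (base n p)"
    by (rule eq[OF depends_on_pd_base[OF Coef_free_eta]] eq[OF depends_on_pd_base[OF Coef_free_xi]]; simp)+
  show ?thesis
    using reduced[OF p] reduced[OF qR]
    unfolding sum D y td pd eq[OF depends_on_prolong_y]
    by (simp add: algebra_simps sum_subtractf)
qed

lemma obtain_shift: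
  assumes b: "b \<in> base_space n B" and k: "k < n - 1"
  obtains c where "c \<in> B (Jet (Coef k) 0)" "c \<noteq> b (Jet (Coef k) 0)"
proof -
  have "open (B (Jet (Coef k) 0))" using k by (intro open_side) auto
  moreover have "b (Jet (Coef k) 0) \<in> B (Jet (Coef k) 0)"
    using b k by (intro jet_regionD) (auto simp: base_space_alt)
  ultimately have "B (Jet (Coef k) 0) \<noteq> {b (Jet (Coef k) 0)} \<and> b (Jet (Coef k) 0) \<in> B (Jet (Coef k) 0)"
    using not_open_singleton by metis
  then show ?thesis using that by blast
qed

text \<open>For \<open>n \<ge> 3\<close> vary \<open>c\<^sub>1\<close>: \<open>\<eta>\<^sub>1 - y' \<cdot> slope\<close> contains \<open>n \<xi>\<^sub>y y'\<^sup>2\<close>, while the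
  unknown differences of the \<open>\<phi>\<^sub>m\<close> contribute at most linearly in \<open>y'\<close>. For \<open>n = 2\<close> the only coefficient is \<open>c\<^sub>0\<close>, and already the term
  linear in \<open>y'\<close> suffices.\<close>

lemma pd_y_xi:
  assumes b: "b \<in> base_space n B"
  shows "pd Y \<xi> b = 0"
proof (cases "n = 2")
  case True
  obtain c where c: "c \<in> B (Jet (Coef 0) 0)" "c \<noteq> b (Jet (Coef 0) 0)"
    using obtain_shift[OF b, of 0] True by auto
  have *: "(c - b (Jet (Coef 0) 0)) * (\<eta> b - b Y * (pd Y \<eta> b - s * pd Y \<xi> b
      - 2 * (pd Indep \<xi> b + s * pd Y \<xi> b))) + (\<phi> (Coef 0) (b(Jet (Coef 0) 0 := c)) - \<phi> (Coef 0) b) * b Y = 0" for s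
  proof -
    let ?p = "jet_over b (\<lambda>j. if j = 1 then s else 0)"
    show ?thesis
      using jet_over_region(2)[OF b, of "\<lambda>j. if j = 1 then s else 0"]
        coefficient_shift[OF jet_over_region(1)[OF b], of 0 c _ "\<lambda>j. if j = 1 then s else 0"] c True b
        tderiv_y[OF Coef_free_xi jet_over_region(1)[OF b]]
      by (simp add: jet_over_region base_upd_in)
  qed
  have "(c - b (Jet (Coef 0) 0)) * b Y * (3 * pd Y \<xi> b) = 0"
    using *[of 0] *[of 1] by algebra
  then show ?thesis using c y_ne_0[OF b] by simp
next
  case False
  then have n: "1 < n - 1" using order_ge_2 by simp
  obtain c where c: "c \<in> B (Jet (Coef 1) 0)" "c \<noteq> b (Jet (Coef 1) 0)"
    using obtain_shift[OF b n] .
  let ?D = "\<lambda>m. \<phi> (Coef m) (b(Jet (Coef 1) 0 := c)) - \<phi> (Coef m) b"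
  have *: "(c - b (Jet (Coef 1) 0)) * (pd Indep \<eta> b + s * pd Y \<eta> b - s * (pd Indep \<xi> b + s * pd Y \<xi> b)
      - s * (pd Y \<eta> b - s * pd Y \<xi> b - real n * (pd Indep \<xi> b + s * pd Y \<xi> b))) + (?D 0 * b Y + ?D 1 * s) = 0" for s
  proof -
    let ?p = "jet_over b (\<lambda>j. if j = 1 then s else 0)"
    have "(\<Sum>m<n - 1. ?D m * ?p (Jet DepY m)) = (\<Sum>m\<in>{0,1}. ?D m * ?p (Jet DepY m))"
      using n by (intro sum.mono_neutral_right) auto
    then show ?thesis
      using coefficient_shift[OF jet_over_region(1)[OF b] n c(1) refl, of "\<lambda>j. if j = 1 then s else 0"] b n
        tderiv_y[OF Coef_free_xi jet_over_region(1)[OF b]] tderiv_y[OF Coef_free_eta jet_over_region(1)[OF b]]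
      by (simp add: jet_over_region base_upd_in)
  qed
  have "(c - b (Jet (Coef 1) 0)) * (2 * real n * pd Y \<xi> b) = 0"
    using *[of 0] *[of 1] *[of "-1"] by algebra
  then show ?thesis using c order_ge_2 by simp
qed

end

context symmetry
begin

lemma xi_depends: "depends_on {Indep} (\<lambda>p. \<xi> (base n p))"
proof (rule depends_on_mono)
  show "depends_on (jcoords n 0 - (jcoords n 0 - {Indep})) (\<lambda>p. \<xi> (base n p))"
    by (rule depends_on_if_pd_0[OF smooth_xi])
      (auto simp: finite_jcoords jcoords_def dvars_def pd_y_xi pd_Coef_eq_0)
qed auto

abbreviation "DX g \<equiv> pd Indep g"
abbreviation "DY g \<equiv> pd Y g"

lemma tderiv_xi: "p \<in> R \<Longrightarrow> tderiv \<xi> p = DX \<xi> (base n p)"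
  by (simp add: tderiv_y[OF Coef_free_xi] pd_y_xi base_in)

lemma DY_DX_xi: "b \<in> base_space n B \<Longrightarrow> DY (DX \<xi>) b = 0"
  by (rule pd_base_notin[OF depends_on_pd_base[OF xi_depends]]) auto

lemma has_DX:
  assumes "smooth_base n B g" "p \<in> R"
  shows "((\<lambda>t. g (base n (p(Indep := t)))) has_real_derivative DX g (base n p)) (at (p Indep))"
  by (rule smooth_base_region_has_pd) (use assms in auto)

lemma has_DY:
  assumes "smooth_base n B g" "p \<in> R"
  shows "((\<lambda>t. g (base n (p(Y := t)))) has_real_derivative DY g (base n p)) (at (p Y))"
  by (rule smooth_base_region_has_pd) (use assms in auto)

lemma prolong_y_1_eq:
  assumes "p \<in> R"
  shows "prolong_y \<xi> \<phi> 1 p = DX \<eta> (base n p) + p (Jet DepY 1) * (DY \<eta> (base n p) - DX \<xi> (base n p))"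
  unfolding prolong_y_1 using assms by (simp add: tderiv_y[OF Coef_free_eta] tderiv_xi algebra_simps)

lemma prolong_y_2_eq:
  assumes p: "p \<in> R"
  shows "prolong_y \<xi> \<phi> 2 p = DX (DX \<eta>) (base n p)
    + p (Jet DepY 1) * (DX (DY \<eta>) (base n p) + DY (DX \<eta>) (base n p) - DX (DX \<xi>) (base n p))
    + p (Jet DepY 1) * p (Jet DepY 1) * DY (DY \<eta>) (base n p)
    + p (Jet DepY 2) * (DY \<eta> (base n p) - 2 * DX \<xi> (base n p))"
proof -
  let ?F = "\<lambda>p. DX \<eta> (base n p) + p (Jet DepY 1) * (DY \<eta> (base n p) - DX \<xi> (base n p))"
  note sm = smooth_base_pd[OF smooth_xi] smooth_base_pd[OF smooth_eta]
  have "prolong_y \<xi> \<phi> 2 p = DX ?F p + (\<Sum>j\<le>1. p (Jet DepY (Suc j)) * pd (Jet DepY j) ?F p)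
      - p (Jet DepY 2) * tderiv \<xi> p"
    using prolong_y_Suc[OF depends_on_prolong_y p prolong_y_1_eq]
    by (simp only: numeral_2_eq_2 One_nat_def)
  then have "prolong_y \<xi> \<phi> 2 p = DX ?F p + (p (Jet DepY 1) * DY ?F p + p (Jet DepY 2) * pd (Jet DepY 1) ?F p)
      - p (Jet DepY 2) * tderiv \<xi> p"
    by (simp add: numeral_2_eq_2)
  moreover have "DX ?F p = DX (DX \<eta>) (base n p) + p (Jet DepY 1) * (DX (DY \<eta>) (base n p) - DX (DX \<xi>) (base n p))"
    by (rule pd_eqI) (auto intro!: derivative_eq_intros has_DX sm p)
  moreover have "DY ?F p = DY (DX \<eta>) (base n p) + p (Jet DepY 1) * (DY (DY \<eta>) (base n p) - DY (DX \<xi>) (base n p))"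
    by (rule pd_eqI) (auto intro!: derivative_eq_intros has_DY sm p)
  moreover have "pd (Jet DepY 1) ?F p = DY \<eta> (base n p) - DX \<xi> (base n p)"
    by (rule pd_eqI) (auto intro!: derivative_eq_intros simp: base_upd_out)
  moreover have "DY (DX \<xi>) (base n p) = 0" by (rule DY_DX_xi[OF base_in[OF p]])
  ultimately show ?thesis
    using tderiv_xi[OF p] by algebra
qed

text \<open>For vanishing \<open>y\<^sup>(\<^sup>3\<^sup>)\<close> the coefficient is affine in \<open>y''\<close>; it is this slope that determines
  \<open>\<eta>\<^sub>y\<^sub>y\<close> when \<open>n = 3\<close>.\<close>

lemma prolong_y_3_eq:
  assumes p: "p \<in> R" and 0: "p (Jet DepY 3) = 0"
  shows "prolong_y \<xi> \<phi> 3 p = DX (DX (DX \<eta>)) (base n p)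
    + p (Jet DepY 1) * (DX (DX (DY \<eta>)) (base n p) + DX (DY (DX \<eta>)) (base n p) - DX (DX (DX \<xi>)) (base n p))
    + p (Jet DepY 1) * p (Jet DepY 1) * DX (DY (DY \<eta>)) (base n p)
    + p (Jet DepY 1) * (DY (DX (DX \<eta>)) (base n p)
    + p (Jet DepY 1) * (DY (DX (DY \<eta>)) (base n p) + DY (DY (DX \<eta>)) (base n p) - DY (DX (DX \<xi>)) (base n p))
    + p (Jet DepY 1) * p (Jet DepY 1) * DY (DY (DY \<eta>)) (base n p))
    + p (Jet DepY 2) * (2 * DX (DY \<eta>) (base n p) + DY (DX \<eta>) (base n p) - 3 * DX (DX \<xi>) (base n p)
        + 3 * p (Jet DepY 1) * DY (DY \<eta>) (base n p))"
proof -
  let ?F = "\<lambda>p. DX (DX \<eta>) (base n p)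
    + p (Jet DepY 1) * (DX (DY \<eta>) (base n p) + DY (DX \<eta>) (base n p) - DX (DX \<xi>) (base n p))
    + p (Jet DepY 1) * p (Jet DepY 1) * DY (DY \<eta>) (base n p)
    + p (Jet DepY 2) * (DY \<eta> (base n p) - 2 * DX \<xi> (base n p))"
  note sm = smooth_base_pd[OF smooth_xi] smooth_base_pd[OF smooth_eta]
    smooth_base_pd[OF smooth_base_pd[OF smooth_xi]] smooth_base_pd[OF smooth_base_pd[OF smooth_eta]]
  have "prolong_y \<xi> \<phi> 3 p = DX ?F p + (\<Sum>j\<le>2. p (Jet DepY (Suc j)) * pd (Jet DepY j) ?F p)
      - p (Jet DepY 3) * tderiv \<xi> p"
    using prolong_y_Suc[OF depends_on_prolong_y p prolong_y_2_eq]
    by (simp only: numeral_3_eq_3 numeral_2_eq_2)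
  then have "prolong_y \<xi> \<phi> 3 p = DX ?F p + p (Jet DepY 1) * DY ?F p + p (Jet DepY 2) * pd (Jet DepY 1) ?F p"
    using 0 by (simp add: numeral_3_eq_3 numeral_2_eq_2)
  moreover have "DX ?F p = DX (DX (DX \<eta>)) (base n p)
    + p (Jet DepY 1) * (DX (DX (DY \<eta>)) (base n p) + DX (DY (DX \<eta>)) (base n p) - DX (DX (DX \<xi>)) (base n p))
    + p (Jet DepY 1) * p (Jet DepY 1) * DX (DY (DY \<eta>)) (base n p)
    + p (Jet DepY 2) * (DX (DY \<eta>) (base n p) - 2 * DX (DX \<xi>) (base n p))"
    by (rule pd_eqI) (auto intro!: derivative_eq_intros has_DX sm p)
  moreover have "DY ?F p = DY (DX (DX \<eta>)) (base n p)
    + p (Jet DepY 1) * (DY (DX (DY \<eta>)) (base n p) + DY (DY (DX \<eta>)) (base n p) - DY (DX (DX \<xi>)) (base n p))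
    + p (Jet DepY 1) * p (Jet DepY 1) * DY (DY (DY \<eta>)) (base n p)
    + p (Jet DepY 2) * (DY (DY \<eta>) (base n p) - 2 * DY (DX \<xi>) (base n p))"
    by (rule pd_eqI) (auto intro!: derivative_eq_intros has_DY sm p)
  moreover have "pd (Jet DepY 1) ?F p = DX (DY \<eta>) (base n p) + DY (DX \<eta>) (base n p) - DX (DX \<xi>) (base n p)
      + 2 * p (Jet DepY 1) * DY (DY \<eta>) (base n p)"
    by (rule pd_eqI) (auto intro!: derivative_eq_intros simp: base_upd_out)
  moreover have "DY (DX \<xi>) (base n p) = 0" by (rule DY_DX_xi[OF base_in[OF p]])
  ultimately show ?thesis
    by algebra
qed

text \<open>With \<open>\<xi> = f(x)\<close> the slope no longer involves \<open>y'\<close>, and \<open>\<eta>\<^sub>2\<close> has the single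
  nonlinear term \<open>\<eta>\<^sub>y\<^sub>y y'\<^sup>2\<close>. It can be isolated by varying \<open>c\<^sub>2\<close> if there is one, that is for
  \<open>n \<ge> 4\<close>, and it is part of the symmetry condition itself for \<open>n = 2\<close>. For \<open>n = 3\<close> the term
  \<open>3 \<eta>\<^sub>y\<^sub>y y' y''\<close> of \<open>\<eta>\<^sub>3\<close> plays this part.\<close>

lemma pd_yy_eta:
  assumes b: "b \<in> base_space n B"
  shows "DY (DY \<eta>) b = 0"
proof -
  define s where "s t r = (\<lambda>j :: nat. if j = 1 then t else if j = 2 then r else 0 :: real)" for t r
  note p = jet_over_region[OF b]
  have [simp]: "s t r 1 = t" "s t r (Suc 0) = t" "s t r 2 = r" "3 \<le> j \<Longrightarrow> s t r j = 0" for t r j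
    by (auto simp: s_def)
  consider "n = 2" | "n = 3" | "n \<ge> 4" using order_ge_2 by linarith
  then show ?thesis
  proof cases
    case 1
    have *: "DX (DX \<eta>) b + t * (DX (DY \<eta>) b + DY (DX \<eta>) b - DX (DX \<xi>) b) + t * t * DY (DY \<eta>) b
      - b (Jet (Coef 0) 0) * b Y * (DY \<eta> b - 2 * DX \<xi> b) + b (Jet (Coef 0) 0) * \<eta> b + \<phi> (Coef 0) b * b Y = 0" for t
    proof -
      let ?p = "jet_over b (s t 0)"
      have y: "?p (Jet DepY 1) = t" "?p (Jet DepY 2) = 0" by simp_all
      have D: "Delta n ?p = b (Jet (Coef 0) 0) * b Y" using 1 by (simp add: Delta_def)
      have s: "(\<Sum>k<n - 1. g k) = g 0" for g :: "nat \<Rightarrow> real" using 1 by simp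
      have n: "prolong_y \<xi> \<phi> n ?p = prolong_y \<xi> \<phi> 2 ?p" "real n = 2" using 1 by simp_all
      show ?thesis
        using reduced[OF p(1), of "s t 0"] prolong_y_2_eq[OF p(1), of "s t 0"] pd_y_xi[OF b]
        unfolding n D s y p(2) tderiv_xi[OF p(1)] prolong_coeff.simps(1) jet_over_simps(2) by algebra
    qed
    show ?thesis using *[of 0] *[of 1] *[of "-1"] by algebra
  next
    case 2
    have *: "(2 * DX (DY \<eta>) b + DY (DX \<eta>) b - 3 * DX (DX \<xi>) b + 3 * t * DY (DY \<eta>) b) = 0" for t
    proof -
      let ?p = "\<lambda>r. jet_over b (s t r)"
      have y: "?p r (Jet DepY 1) = t" "?p r (Jet DepY 2) = r" "?p r (Jet DepY 3) = 0" for r by simp_all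
      have D: "Delta n (?p r) = b (Jet (Coef 0) 0) * b Y + b (Jet (Coef 1) 0) * t" for r
        using 2 by (simp add: Delta_def numeral_2_eq_2)
      have s: "(\<Sum>k<n - 1. g k) = g 0 + g 1" for g :: "nat \<Rightarrow> real" using 2 by (simp add: numeral_2_eq_2)
      have n: "prolong_y \<xi> \<phi> n q = prolong_y \<xi> \<phi> 3 q" for q using 2 by simp
      show ?thesis
        using reduced[OF p(1), of "s t 0"] prolong_y_3_eq[OF p(1) y(3), of 0]
          reduced[OF p(1), of "s t 1"] prolong_y_3_eq[OF p(1) y(3), of 1]
        unfolding n D s y p(2) tderiv_xi[OF p(1)] prolong_y_1_eq[OF p(1)] prolong_coeff.simps(1) jet_over_simps(2)
        by algebra
    qed
    show ?thesis using *[of 0] *[of 1] by algebra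
  next
    case 3
    then have n: "2 < n - 1" by simp
    obtain c where c: "c \<in> B (Jet (Coef 2) 0)" "c \<noteq> b (Jet (Coef 2) 0)"
      using obtain_shift[OF b n] .
    let ?D = "\<lambda>m. \<phi> (Coef m) (b(Jet (Coef 2) 0 := c)) - \<phi> (Coef m) b"
    have *: "(c - b (Jet (Coef 2) 0)) * (DX (DX \<eta>) b
        + t * (DX (DY \<eta>) b + DY (DX \<eta>) b - DX (DX \<xi>) b) + t * t * DY (DY \<eta>) b)
      + (?D 0 * b Y + ?D 1 * t) = 0" for t
    proof -
      let ?p = "jet_over b (s t 0)"
      have y: "?p (Jet DepY 1) = t" "?p (Jet DepY 2) = 0" by simp_all
      have up: "base n (?p(Jet (Coef 2) 0 := c)) = b(Jet (Coef 2) 0 := c)"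
        using n by (simp add: base_upd_in p(2))
      have "(\<Sum>m<n - 1. ?D m * ?p (Jet DepY m)) = (\<Sum>m\<in>{0,1}. ?D m * ?p (Jet DepY m))"
        using n by (intro sum.mono_neutral_right) (auto simp: s_def)
      then have "(\<Sum>m<n - 1. ?D m * ?p (Jet DepY m)) = ?D 0 * b Y + ?D 1 * t" by simp
      then show ?thesis
        using coefficient_shift[OF p(1) n c(1) refl, of "s t 0"] prolong_y_2_eq[OF p(1), of "s t 0"]
        unfolding up p(2) y jet_over_simps(2) by algebra
    qed
    have "(c - b (Jet (Coef 2) 0)) * (2 * DY (DY \<eta>) b) = 0"
      using *[of 0] *[of 1] *[of "-1"] by algebra
    then show ?thesis using c by simp
  qed
qed

text \<open>Smoothness on the box restricts to lines parallel to the \<open>x\<close>-axis; the functions \<open>f\<close>,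
  \<open>\<alpha>\<close>, \<open>h\<close> below are obtained on such a line.\<close>

lemma slice_smooth:
  assumes g: "smooth_base n B g" and b: "b \<in> base_space n B"
  shows "smooth_real (B Indep) (\<lambda>x. g (b(Indep := x)))"
proof (rule smooth_realI)
  have sm: "smooth_base n B ((pd Indep ^^ j) g)" for j
    by (induction j) (auto simp: g intro!: smooth_base_pd)
  show "((\<lambda>x. (pd Indep ^^ j) g (b(Indep := x))) has_real_derivative (pd Indep ^^ Suc j) g (b(Indep := x))) (at x)"
    if "x \<in> B Indep" for j x
    using smooth_base_has_pd[OF sm Indep_in_jcoords base_upd[OF b Indep_in_jcoords that], of j] by (simp only: fun_upd_upd fun_upd_same funpow.simps o_apply)
qed (simp_all only: funpow.simps id_apply open_side Indep_in_jcoords)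

text \<open>As \<open>\<xi>\<^sub>y\<close>, \<open>\<eta>\<^sub>y\<^sub>y\<close> and all derivatives along coefficients vanish, \<open>\<xi>\<close>, \<open>\<eta>\<^sub>y\<close> and
  \<open>\<eta> - y \<eta>\<^sub>y\<close> are constant in every direction but that of \<open>x\<close>.\<close>

lemma determine_xi_eta:
  "\<exists>f \<alpha> h. smooth_real (B Indep) f \<and> smooth_real (B Indep) \<alpha> \<and> smooth_real (B Indep) h \<and>
     (\<forall>b\<in>base_space n B. \<xi> b = f (b Indep) \<and> \<eta> b = \<alpha> (b Indep) * b Y + h (b Indep))"
proof -
  obtain b0 where b0: "b0 \<in> base_space n B" using base_space_nonempty by blast
  note sm = smooth_base_pd[OF smooth_eta]
  let ?f = "\<lambda>x. \<xi> (b0(Indep := x))"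
  let ?a = "\<lambda>x. DY \<eta> (b0(Indep := x))"
  let ?h = "\<lambda>x. 1 * \<eta> (b0(Indep := x)) + (- b0 Y) * ?a x + 0"
  have upd: "b0(Indep := b Indep) \<in> base_space n B" if "b \<in> base_space n B" for b
    using that b0 by (intro base_upd) (auto simp: base_space_alt jet_regionD)
  have x_only: "g b = g (b0(Indep := b Indep))"
    if "\<And>b i. b \<in> base_space n B \<Longrightarrow> i \<in> jcoords n 0 - {Indep} \<Longrightarrow>
        ((\<lambda>t. g (b(i := t))) has_real_derivative 0) (at (b i))" "b \<in> base_space n B" for g b
    by (rule base_cong_const[where F = g and S = "jcoords n 0 - {Indep}"])
      (use that upd finite_jcoords in auto)
  have cases: "i = Y \<or> (\<exists>k<n - 1. i = Jet (Coef k) 0)" if "i \<in> jcoords n 0 - {Indep}" for i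
    using that by (auto simp: jcoords_def dvars_def)
  have C: "pd (Jet (Coef k) 0) (DY \<eta>) b = 0" if "k < n - 1" "b \<in> base_space n B" for k b
    by (rule pd_base_notin[OF depends_on_pd_base[OF Coef_free_eta]]) (use that in auto)
  have xi: "\<xi> b = ?f (b Indep)" if b: "b \<in> base_space n B" for b
  proof (rule x_only[OF _ b])
    fix b i assume "b \<in> base_space n B" "i \<in> jcoords n 0 - {Indep}"
    then show "((\<lambda>t. \<xi> (b(i := t))) has_real_derivative 0) (at (b i))"
      using smooth_base_has_pd[OF smooth_xi, of i b] cases[of i] pd_y_xi pd_Coef_eq_0(1) by auto
  qed
  have DYeta: "DY \<eta> b = ?a (b Indep)" if b: "b \<in> base_space n B" for b
  proof (rule x_only[OF _ b])
    fix b i assume "b \<in> base_space n B" "i \<in> jcoords n 0 - {Indep}"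
    then show "((\<lambda>t. DY \<eta> (b(i := t))) has_real_derivative 0) (at (b i))"
      using smooth_base_has_pd[OF sm, of Y i b] cases[of i] pd_yy_eta C by auto
  qed
  have "\<eta> b - b Y * DY \<eta> b = \<eta> (b0(Indep := b Indep)) - (b0(Indep := b Indep)) Y * DY \<eta> (b0(Indep := b Indep))"
    if b: "b \<in> base_space n B" for b
  proof (rule x_only[where g = "\<lambda>b. \<eta> b - b Y * DY \<eta> b", OF _ b])
    fix b i assume b: "b \<in> base_space n B" and i: "i \<in> jcoords n 0 - {Indep}"
    have e: "((\<lambda>t. \<eta> (b(i := t))) has_real_derivative pd i \<eta> b) (at (b i))"
      "((\<lambda>t. DY \<eta> (b(i := t))) has_real_derivative 0) (at (b i))"
      using smooth_base_has_pd[OF smooth_eta, of i b] smooth_base_has_pd[OF sm, of Y i b] cases[OF i] pd_yy_eta[OF b] C[OF _ b] b i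
      by auto
    show "((\<lambda>t. \<eta> (b(i := t)) - (b(i := t)) Y * DY \<eta> (b(i := t))) has_real_derivative 0) (at (b i))"
    proof (cases "i = Y")
      case True
      then show ?thesis
        using e by (auto intro!: derivative_eq_intros)
    next
      case False
      then have "pd i \<eta> b = 0" using cases[OF i] pd_Coef_eq_0(2)[OF b] by auto
      then show ?thesis
        using e False by (auto intro!: derivative_eq_intros)
    qed
  qed
  then have "\<eta> b = ?a (b Indep) * b Y + ?h (b Indep)" if "b \<in> base_space n B" for b
    using that DYeta[OF that] by (simp add: algebra_simps)
  moreover have "smooth_real (B Indep) ?h"
    by (rule smooth_real_affine[OF _ slice_smooth[OF smooth_eta b0] slice_smooth[OF sm b0]])
      (auto simp: open_side)
  ultimately show ?thesis
    using slice_smooth[OF smooth_xi b0] slice_smooth[OF sm b0, of Y] xi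
    by (intro exI[of _ ?f] exI[of _ ?a] exI[of _ ?h]) auto
qed

end

section \<open>Prolongation of fields that are affine in y\<close>

text \<open>For \<open>\<xi> = f(x)\<close> and \<open>\<eta> = \<alpha>(x) y + h(x)\<close> the coefficient of
  \<open>y\<^sup>(\<^sup>m\<^sup>-\<^sup>i\<^sup>)\<close> in the prolongation to order \<open>m\<close>; it is read off from Leibniz' rule for
  \<open>D\<^sup>m (\<eta> - f y') + f y\<^sup>(\<^sup>m\<^sup>+\<^sup>1\<^sup>)\<close>.\<close>

definition prolong_weight :: "(real \<Rightarrow> real) \<Rightarrow> (real \<Rightarrow> real) \<Rightarrow> nat \<Rightarrow> nat \<Rightarrow> real \<Rightarrow> real" where
  "prolong_weight f \<alpha> m i x =
     real (m choose i) * (deriv ^^ i) \<alpha> x - real (m choose Suc i) * (deriv ^^ Suc i) f x"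

lemma prolong_weight_has_derivative:
  assumes "smooth_real I f" "smooth_real I \<alpha>" "x \<in> I"
  shows "(prolong_weight f \<alpha> m i has_real_derivative
    real (m choose i) * (deriv ^^ Suc i) \<alpha> x - real (m choose Suc i) * (deriv ^^ Suc (Suc i)) f x) (at x)"
  unfolding prolong_weight_def
  by (intro DERIV_diff DERIV_cmult smooth_real_has_derivative[OF assms(1,3)] smooth_real_has_derivative[OF assms(2,3)])

lemma prolong_weight_Suc:
  "prolong_weight f \<alpha> (Suc m) (Suc i) x = real (m choose i) * (deriv ^^ Suc i) \<alpha> x
     - real (m choose Suc i) * (deriv ^^ Suc (Suc i)) f x + prolong_weight f \<alpha> m (Suc i) x"
  by (simp add: prolong_weight_def algebra_simps)

lemma prolong_weight_0: "prolong_weight f \<alpha> m 0 x = \<alpha> x - real m * deriv f x"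
  by (simp add: prolong_weight_def)

context jet_box
begin

definition affine_field ::
  "(real \<Rightarrow> real) \<Rightarrow> (real \<Rightarrow> real) \<Rightarrow> (real \<Rightarrow> real) \<Rightarrow> (jet \<Rightarrow> real) \<Rightarrow> (dvar \<Rightarrow> jet \<Rightarrow> real) \<Rightarrow> bool" where
  "affine_field f \<alpha> h \<xi> \<phi> \<longleftrightarrow>
     smooth_real (B Indep) f \<and> smooth_real (B Indep) \<alpha> \<and> smooth_real (B Indep) h \<and>
     (\<forall>b\<in>base_space n B.
        \<xi> b = f (b Indep) \<and> \<phi> DepY b = \<alpha> (b Indep) * b (Jet DepY 0) + h (b Indep))"

lemma prolong_y_affine:
  assumes field: "affine_field f \<alpha> h \<xi> \<phi>" and "p \<in> R"
  shows "prolong_y \<xi> \<phi> m p =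
    (\<Sum>l\<le>m. p (Jet DepY l) * prolong_weight f \<alpha> m (m - l) (p Indep)) + (deriv ^^ m) h (p Indep)"
  using assms(2)
proof (induction m arbitrary: p)
  case 0
  then show ?case
    using field base_in[OF 0] by (simp add: prolong_weight_def affine_field_def)
next
  case (Suc m)
  let ?x = "p Indep"
  let ?F = "\<lambda>p. (\<Sum>l\<le>m. p (Jet DepY l) * prolong_weight f \<alpha> m (m - l) (p Indep)) + (deriv ^^ m) h (p Indep)"
  let ?W = "\<lambda>i. real (m choose i) * (deriv ^^ Suc i) \<alpha> ?x - real (m choose Suc i) * (deriv ^^ Suc (Suc i)) f ?x"
  have x: "?x \<in> B Indep" using Suc.prems by (rule jet_regionD) simp
  have eq: "\<xi> (base n q) = f (q Indep)" "\<phi> DepY (base n q) = \<alpha> (q Indep) * q (Jet DepY 0) + h (q Indep)"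
    if "q \<in> R" for q
    using field base_in[OF that] by (simp_all add: affine_field_def)
  have dep: "depends_on (y_coords 0) (\<lambda>p. \<xi> (base n p))" "depends_on (y_coords 0) (\<lambda>p. \<phi> DepY (base n p))"
    unfolding depends_on_def by (intro ballI impI, simp only: eq Indep_in_y_coords Jet_in_y_coords order_refl simp_thms)+
  have td: "tderiv \<xi> p = deriv f ?x"
  proof -
    have "pd Indep (\<lambda>q. \<xi> (base n q)) p = pd Indep (\<lambda>q. f (q Indep)) p"
      "pd (Jet DepY 0) (\<lambda>q. \<xi> (base n q)) p = pd (Jet DepY 0) (\<lambda>q. f (q Indep)) p"
      by (rule pd_cong[OF Suc.prems eq(1)]; simp)+
    then show ?thesis
      using total_deriv_y[OF dep(1) Suc.prems] by (simp add: pd_def)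
  qed
  have "prolong_y \<xi> \<phi> (Suc m) p = pd Indep ?F p
    + (\<Sum>j\<le>m. p (Jet DepY (Suc j)) * pd (Jet DepY j) ?F p) - p (Jet DepY (Suc m)) * tderiv \<xi> p"
  proof (rule prolong_y_Suc[OF _ Suc.prems Suc.IH])
    show "depends_on (y_coords m) (prolong_y \<xi> \<phi> m)"
      by (rule depends_on_prolong_coeff[of y_coords]) (simp_all add: dep mono_y_coords)
  qed
  also have "pd Indep ?F p = (\<Sum>l\<le>m. p (Jet DepY l) * ?W (m - l)) + (deriv ^^ Suc m) h ?x"
  proof (rule pd_eqI)
    have "((\<lambda>t. (\<Sum>l\<le>m. p (Jet DepY l) * prolong_weight f \<alpha> m (m - l) t) + (deriv ^^ m) h t) has_real_derivative
      (\<Sum>l\<le>m. p (Jet DepY l) * ?W (m - l)) + (deriv ^^ Suc m) h ?x) (at ?x)"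
      by (intro DERIV_add DERIV_sum DERIV_cmult prolong_weight_has_derivative[of "B Indep"]
        smooth_real_has_derivative[of "B Indep"] x) (use field in \<open>auto simp: affine_field_def\<close>)
    then show "((\<lambda>t. ?F (p(Indep := t))) has_real_derivative
      (\<Sum>l\<le>m. p (Jet DepY l) * ?W (m - l)) + (deriv ^^ Suc m) h ?x) (at ?x)"
      by simp
  qed
  also have "(\<Sum>j\<le>m. p (Jet DepY (Suc j)) * pd (Jet DepY j) ?F p) =
    (\<Sum>j\<le>m. p (Jet DepY (Suc j)) * prolong_weight f \<alpha> m (m - j) ?x)"
  proof (intro sum.cong refl)
    fix j assume j: "j \<in> {..m}"
    have "pd (Jet DepY j) ?F p = prolong_weight f \<alpha> m (m - j) ?x"
    proof (rule pd_affine)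
      fix t
      have "(\<Sum>l\<le>m. (p(Jet DepY j := t)) (Jet DepY l) * prolong_weight f \<alpha> m (m - l) ?x) =
        (\<Sum>l\<le>m. p (Jet DepY l) * prolong_weight f \<alpha> m (m - l) ?x
          + (if l = j then (t - p (Jet DepY j)) * prolong_weight f \<alpha> m (m - j) ?x else 0))"
        by (intro sum.cong refl) (auto simp: algebra_simps)
      then show "?F (p(Jet DepY j := t)) = ?F p + (t - p (Jet DepY j)) * prolong_weight f \<alpha> m (m - j) ?x"
        using j by (simp add: sum.distrib)
    qed
    then show "p (Jet DepY (Suc j)) * pd (Jet DepY j) ?F p = p (Jet DepY (Suc j)) * prolong_weight f \<alpha> m (m - j) ?x"
      by simp
  qed
  also have "(\<Sum>l\<le>m. p (Jet DepY l) * ?W (m - l)) + (deriv ^^ Suc m) h ?x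
      + (\<Sum>j\<le>m. p (Jet DepY (Suc j)) * prolong_weight f \<alpha> m (m - j) ?x) - p (Jet DepY (Suc m)) * tderiv \<xi> p
    = (\<Sum>l\<le>Suc m. p (Jet DepY l) * prolong_weight f \<alpha> (Suc m) (Suc m - l) ?x) + (deriv ^^ Suc m) h ?x"
  proof -
    have "(\<Sum>j\<le>m. p (Jet DepY (Suc j)) * prolong_weight f \<alpha> m (m - j) ?x)
      = (\<Sum>l\<in>{1..Suc m}. p (Jet DepY l) * prolong_weight f \<alpha> m (Suc m - l) ?x)"
      by (rule sum.reindex_bij_witness[of _ "\<lambda>l. l - 1" Suc]) auto
    also have "\<dots> = (\<Sum>l\<le>Suc m. p (Jet DepY l) * prolong_weight f \<alpha> m (Suc m - l) ?x)"
      \<comment> \<open>the additional term contains \<open>m choose (m + 1)\<close>\<close>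
      by (intro sum.mono_neutral_left) (auto simp: not_less_eq_eq prolong_weight_def binomial_eq_0)
    also have "\<dots> = (\<Sum>l\<le>m. p (Jet DepY l) * prolong_weight f \<alpha> m (Suc (m - l)) ?x)
        + p (Jet DepY (Suc m)) * prolong_weight f \<alpha> m 0 ?x"
      by (simp add: Suc_diff_le)
    finally have 1: "(\<Sum>j\<le>m. p (Jet DepY (Suc j)) * prolong_weight f \<alpha> m (m - j) ?x) = \<dots>" .
    have 2: "(\<Sum>l\<le>Suc m. p (Jet DepY l) * prolong_weight f \<alpha> (Suc m) (Suc m - l) ?x) =
        (\<Sum>l\<le>m. p (Jet DepY l) * ?W (m - l) + p (Jet DepY l) * prolong_weight f \<alpha> m (Suc (m - l)) ?x)
        + p (Jet DepY (Suc m)) * prolong_weight f \<alpha> (Suc m) 0 ?x"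
      by (simp add: Suc_diff_le prolong_weight_Suc ring_distribs del: funpow.simps)
    show ?thesis
      unfolding 1 2 td sum.distrib prolong_weight_0 by (simp add: algebra_simps)
  qed
  finally show ?case .
qed

lemma coef_sum: "(\<Sum>k\<le>n. coef n p k * g k) = g n + (\<Sum>k<n - 1. p (Jet (Coef k) 0) * g k)"
proof -
  obtain m where m: "n = Suc (Suc m)" using order_ge_2 by (metis add_2_eq_Suc le_Suc_ex)
  have "{..n} = insert n (insert (n - 1) {..<n - 1})" by (auto simp: m)
  then have "(\<Sum>k\<le>n. coef n p k * g k) = coef n p n * g n + (coef n p (n - 1) * g (n - 1)
      + (\<Sum>k<n - 1. coef n p k * g k))"
    by (simp add: m)
  also have "(\<Sum>k<n - 1. coef n p k * g k) = (\<Sum>k<n - 1. p (Jet (Coef k) 0) * g k)"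
    by (intro sum.cong refl) (auto simp: coef_def)
  finally show ?thesis by (simp add: coef_def m)
qed

lemma Delta_coef: "Delta n p = (\<Sum>k\<le>n. coef n p k * p (Jet DepY k))"
  using coef_sum by (simp add: Delta_def)

text \<open>The coefficient of \<open>y\<^sup>(\<^sup>k\<^sup>)\<close> in the symmetry condition without the \<open>\<phi>\<^sub>k\<close>. The multiple
  of \<open>\<Delta>\<close> that is subtracted makes the weight for \<open>k = n\<close> vanish, so that
  only derivatives remain that \<open>\<Delta> = 0\<close> leaves free.\<close>

definition y_weight :: "(real \<Rightarrow> real) \<Rightarrow> (real \<Rightarrow> real) \<Rightarrow> nat \<Rightarrow> jet \<Rightarrow> real" where
  "y_weight f \<alpha> k p = (\<Sum>j\<le>n - k. coef n p (k + j) * prolong_weight f \<alpha> (k + j) j (p Indep))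
     - coef n p k * prolong_weight f \<alpha> n 0 (p Indep)"

lemma symmetry_sum_affine:
  assumes field: "affine_field f \<alpha> h \<xi> \<phi>" and p: "p \<in> R"
  shows "prolong_y \<xi> \<phi> n p + (\<Sum>k<n - 1. p (Jet (Coef k) 0) * prolong_y \<xi> \<phi> k p) =
    (\<Sum>k<n. p (Jet DepY k) * y_weight f \<alpha> k p) + (\<Sum>k\<le>n. coef n p k * (deriv ^^ k) h (p Indep))
    + prolong_weight f \<alpha> n 0 (p Indep) * Delta n p"
proof -
  let ?w = "\<lambda>m i. prolong_weight f \<alpha> m i (p Indep)" and ?c = "coef n p" and ?y = "\<lambda>l. p (Jet DepY l)"
  have "prolong_y \<xi> \<phi> n p + (\<Sum>k<n - 1. p (Jet (Coef k) 0) * prolong_y \<xi> \<phi> k p)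
    = (\<Sum>m\<le>n. ?c m * prolong_y \<xi> \<phi> m p)"
    using coef_sum by simp
  also have "\<dots> = (\<Sum>m\<le>n. \<Sum>l\<le>m. ?c m * (?y l * ?w m (m - l))) + (\<Sum>m\<le>n. ?c m * (deriv ^^ m) h (p Indep))"
    by (simp add: prolong_y_affine[OF field p] algebra_simps sum.distrib sum_distrib_left)
  also have "(\<Sum>m\<le>n. \<Sum>l\<le>m. ?c m * (?y l * ?w m (m - l))) =
    (\<Sum>k\<le>n. \<Sum>j\<le>n - k. ?c (k + j) * (?y k * ?w (k + j) j))"
    \<comment> \<open>collect by the order \<open>k\<close> of the derivative of \<open>y\<close>, where \<open>m = k + j\<close>\<close>
    unfolding sum.Sigma[OF finite_atMost ballI[OF finite_atMost]]
    by (rule sum.reindex_bij_witness[of _ "\<lambda>(k, j). (k + j, k)" "\<lambda>(m, l). (l, m - l)"]) auto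
  also have "\<dots> = (\<Sum>k\<le>n. ?y k * (y_weight f \<alpha> k p + ?c k * ?w n 0))"
    by (simp add: y_weight_def sum_distrib_left algebra_simps)
  also have "\<dots> = (\<Sum>k\<le>n. ?y k * y_weight f \<alpha> k p) + ?w n 0 * Delta n p"
    by (simp add: Delta_coef sum.distrib sum_distrib_left algebra_simps)
  also have "(\<Sum>k\<le>n. ?y k * y_weight f \<alpha> k p) = (\<Sum>k<n. ?y k * y_weight f \<alpha> k p)"
    by (simp add: lessThan_Suc_atMost[symmetric] y_weight_def)
  finally show ?thesis by simp
qed

lemma coef_cong:
  assumes "m \<le> n" "\<And>k. k < n - 1 \<Longrightarrow> p (Jet (Coef k) 0) = q (Jet (Coef k) 0)"
  shows "coef n p m = coef n q m"
  using assms by (auto simp: coef_def)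

lemma Phi_cong:
  assumes "k \<le> n" "p Indep = q Indep" "\<And>k. k < n - 1 \<Longrightarrow> p (Jet (Coef k) 0) = q (Jet (Coef k) 0)"
  shows "Phi n f k p = Phi n f k q"
proof -
  have "coef n p m = coef n q m" if "m \<le> n" for m
    by (rule coef_cong[OF that]) (rule assms(3))
  then show ?thesis
    using assms(1) unfolding Phi_def assms(2)
    by (intro arg_cong2[of _ _ _ _ "(+)"] sum.cong) auto
qed

text \<open>This weight stands alone in the symmetry condition, because there is no coefficient
  \<open>c\<^sub>n\<^sub>-\<^sub>1\<close> whose component could compensate it. Its vanishing ties \<open>\<alpha>\<close> to \<open>f'\<close>.\<close>

lemma y_weight_subtop:
  "y_weight f \<alpha> (n - 1) p = real n * deriv \<alpha> (p Indep) - real n * (real n - 1) / 2 * deriv (deriv f) (p Indep)"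
proof -
  obtain m where m: "n = Suc m" using order_ge_2 by (cases n) auto
  have c: "real (Suc m choose Suc (Suc 0)) = real n * (real n - 1) / 2"
  proof -
    have "2 * (Suc m choose 2) = Suc m * m"
      using choose_two[of "Suc m"] by simp
    then have "2 * real (Suc m choose 2) = real (Suc m) * real m"
      by (metis of_nat_mult of_nat_numeral)
    then show ?thesis by (simp add: m numeral_2_eq_2)
  qed
  show ?thesis
    using c unfolding y_weight_def by (simp add: prolong_weight_def coef_def m numeral_2_eq_2)
qed

text \<open>The summand \<open>j = 0\<close> of the weight and the subtracted multiple of \<open>\<Delta>\<close> combine to
  \<open>(n - k) f' c\<^sub>k\<close>; the constant \<open>k\<^sub>1\<close> cancels.\<close>

lemma y_weight_eq_Phi:
  assumes "k \<le> n"
    and \<alpha>: "\<And>j. (deriv ^^ j) \<alpha> (p Indep) =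
      (real n - 1) / 2 * (deriv ^^ Suc j) f (p Indep) + (if j = 0 then k1 else 0)"
  shows "y_weight f \<alpha> k p = - Phi n f k p"
proof -
  have "(\<Sum>j\<le>n - k. coef n p (k + j) * prolong_weight f \<alpha> (k + j) j (p Indep)) =
     coef n p k * prolong_weight f \<alpha> k 0 (p Indep)
     + (\<Sum>j = 1..n - k. coef n p (k + j) * prolong_weight f \<alpha> (k + j) j (p Indep))"
    by (simp add: atMost_atLeast0 sum.atLeast_Suc_atMost)
  also have "(\<Sum>j = 1..n - k. coef n p (k + j) * prolong_weight f \<alpha> (k + j) j (p Indep)) =
    - (\<Sum>j = 1..n - k. coef n p (k + j)
          * (real ((k + j) choose (j + 1)) - real ((k + j) choose j) * ((real n - 1) / 2))
          * (deriv ^^ (j + 1)) f (p Indep))"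
    unfolding sum_negf[symmetric]
    by (intro sum.cong refl) (simp add: prolong_weight_def \<alpha> algebra_simps del: funpow.simps)
  finally show ?thesis
    unfolding y_weight_def Phi_def prolong_weight_0 by (simp add: algebra_simps)
qed

lemma Phi_h_times_y:
  assumes "p (Jet DepY 0) \<noteq> 0"
  shows "Phi_h n h 0 p * p (Jet DepY 0) = - (\<Sum>k\<le>n. coef n p k * (deriv ^^ k) h (p Indep))"
proof -
  have "(\<Sum>k\<le>n. coef n p k * (deriv ^^ k) h (p Indep)) =
    coef n p 0 * h (p Indep) + (\<Sum>k = 1..n. coef n p k * (deriv ^^ k) h (p Indep))"
    by (simp add: atMost_atLeast0 sum.atLeast_Suc_atMost)
  then show ?thesis
    using assms by (simp add: Phi_h_def ring_distribs sum_distrib_right)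
qed

lemma affine_coefficient:
  assumes f: "smooth_real (B Indep) f"
    and \<alpha>: "\<And>x. x \<in> B Indep \<Longrightarrow> \<alpha> x = (real n - 1) / 2 * deriv f x + k1"
  shows "smooth_real (B Indep) \<alpha>"
    and "x \<in> B Indep \<Longrightarrow> (deriv ^^ j) \<alpha> x = (real n - 1) / 2 * (deriv ^^ Suc j) f x + (if j = 0 then k1 else 0)"
proof -
  let ?G = "\<lambda>x. (real n - 1) / 2 * (deriv ^^ 1) f x + 0 * f x + k1"
  have o: "open (B Indep)" by (simp add: open_side)
  have sm: "smooth_real (B Indep) ((deriv ^^ 1) f)" by (rule smooth_real_deriv[OF o f])
  note G = smooth_real_affine[OF o sm f, of "(real n - 1) / 2" 0 k1]
    iterated_deriv_affine[OF o sm f, where a = "(real n - 1) / 2" and b = 0 and c = k1]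
  have eq: "(deriv ^^ j) \<alpha> x = (deriv ^^ j) ?G x" if "x \<in> B Indep" for j x
    by (rule iterated_deriv_cong[OF o G(1) _ that]) (simp add: \<alpha>)
  show "smooth_real (B Indep) \<alpha>"
    by (rule smooth_realI[of _ _ "\<lambda>j. (deriv ^^ j) ?G", OF o])
      (use \<alpha> smooth_real_has_derivative[OF G(1)] in auto)
  show "(deriv ^^ j) \<alpha> x = (real n - 1) / 2 * (deriv ^^ Suc j) f x + (if j = 0 then k1 else 0)" if "x \<in> B Indep"
    using eq[OF that] G(2)[OF that] by (simp add: funpow_swap1)
qed

end

context symmetry
begin

text \<open>The derivatives \<open>y', \<dots>, y\<^sup>(\<^sup>n\<^sup>-\<^sup>1\<^sup>)\<close> are free, so their coefficients vanish one by one. The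
  value of \<open>y\<close> itself is fixed by the base point, on which the \<open>\<phi>\<^sub>k\<close> may depend, so that its term
  stays together with the inhomogeneous part coming from \<open>h\<close>.\<close>

lemma symmetry_components:
  assumes field: "affine_field f \<alpha> h \<xi> \<phi>" and b: "b \<in> base_space n B"
  shows "y_weight f \<alpha> (n - 1) b = 0"
    and "\<And>k. 1 \<le> k \<Longrightarrow> k < n - 1 \<Longrightarrow> \<phi> (Coef k) b = - y_weight f \<alpha> k b"
    and "b Y * (\<phi> (Coef 0) b + y_weight f \<alpha> 0 b) + (\<Sum>k\<le>n. coef n b k * (deriv ^^ k) h (b Indep)) = 0"
proof -
  define g where "g k = y_weight f \<alpha> k b + (if k < n - 1 then \<phi> (Coef k) b else 0)" for k
  define H where "H = (\<Sum>k\<le>n. coef n b k * (deriv ^^ k) h (b Indep))"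
  have main: "(\<Sum>k<n. (if k = 0 then b Y else s k) * g k) + H = 0" for s
  proof -
    \<comment> \<open>the derivative of order \<open>n\<close> is chosen so that the equation holds\<close>
    define r where "r = s(n := - (\<Sum>k<n - 1. b (Jet (Coef k) 0) * (if k = 0 then b Y else s k)))"
    let ?p = "jet_over b r"
    note p = jet_over_region[OF b, of r]
    have y: "?p (Jet DepY k) = (if k = 0 then b Y else s k)" if "k < n" for k
      using that by (simp add: r_def)
    have D: "Delta n ?p = 0"
    proof -
      have "(\<Sum>k<n - 1. ?p (Jet (Coef k) 0) * ?p (Jet DepY k)) =
        (\<Sum>k<n - 1. b (Jet (Coef k) 0) * (if k = 0 then b Y else s k))"
        by (intro sum.cong refl) (simp add: y)
      then show ?thesis
        using order_ge_2 by (simp add: Delta_def r_def)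
    qed
    have c: "coef n ?p k = coef n b k" if "k \<le> n" for k
      by (rule coef_cong[OF that]) simp
    have w: "y_weight f \<alpha> k ?p = y_weight f \<alpha> k b" if "k < n" for k
      unfolding y_weight_def using that c by simp
    have "(\<Sum>k<n. ?p (Jet DepY k) * y_weight f \<alpha> k ?p) + (\<Sum>k\<le>n. coef n ?p k * (deriv ^^ k) h (?p Indep))
      + prolong_weight f \<alpha> n 0 (?p Indep) * Delta n ?p
      + (\<Sum>k<n - 1. \<phi> (Coef k) (base n ?p) * ?p (Jet DepY k)) = 0"
      using gen p(1) D unfolding generator_GS_alt symmetry_sum_affine[OF field p(1), symmetric] by blast
    moreover have "(\<Sum>k<n. ?p (Jet DepY k) * y_weight f \<alpha> k ?p)
       = (\<Sum>k<n. (if k = 0 then b Y else s k) * y_weight f \<alpha> k b)"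
      by (intro sum.cong refl) (simp add: y w)
    moreover have "(\<Sum>k\<le>n. coef n ?p k * (deriv ^^ k) h (?p Indep)) = H"
      unfolding H_def by (intro sum.cong refl) (simp add: c)
    moreover have "(\<Sum>k<n - 1. \<phi> (Coef k) (base n ?p) * ?p (Jet DepY k)) =
      (\<Sum>k<n. (if k = 0 then b Y else s k) * (if k < n - 1 then \<phi> (Coef k) b else 0))"
      by (intro sum.mono_neutral_cong_left) (auto simp: y p(2))
    ultimately show ?thesis
      by (simp only: D g_def ring_distribs sum.distrib)
  qed
  have zero: "b Y * g 0 + H = 0"
  proof -
    have "(\<Sum>k<n. (if k = 0 then b Y else 0) * g k) = (\<Sum>k<n. if k = 0 then b Y * g k else 0)"
      by (intro sum.cong refl) simp
    then show ?thesis using main[of "\<lambda>_. 0"] order_ge_2 by simp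
  qed
  have pos: "g k = 0" if k: "1 \<le> k" "k < n" for k
  proof -
    have "(\<Sum>l<n. (if l = 0 then b Y else if l = k then 1 else 0) * g l)
        = (\<Sum>l<n. (if l = 0 then b Y * g l else 0) + (if l = k then g l else 0))"
      by (intro sum.cong refl) (use k in auto)
    also have "\<dots> = b Y * g 0 + g k"
      unfolding sum.distrib using k by simp
    finally show ?thesis using main[of "\<lambda>l. if l = k then 1 else 0"] zero by simp
  qed
  show "y_weight f \<alpha> (n - 1) b = 0"
    using pos[of "n - 1"] order_ge_2 by (simp add: g_def)
  show "\<phi> (Coef k) b = - y_weight f \<alpha> k b" if "1 \<le> k" "k < n - 1" for k
  proof -
    have "k < n" using that by linarith
    then show ?thesis using pos[of k] that by (simp add: g_def)
  qed
  show "b Y * (\<phi> (Coef 0) b + y_weight f \<alpha> 0 b) + (\<Sum>k\<le>n. coef n b k * (deriv ^^ k) h (b Indep)) = 0"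
    using zero order_ge_2 by (simp add: g_def H_def add.commute)
qed

theorem symmetry_form:
  "\<exists>f h k\<^sub>1. smooth_real (B Indep) f \<and> smooth_real (B Indep) h \<and>
        (\<forall>p\<in>base_space n B.
           \<xi> p = f (p Indep) \<and>
           \<phi> DepY p =
             p (Jet DepY 0) * ((real n - 1) / 2 * deriv f (p Indep) + k\<^sub>1) + h (p Indep) \<and>
           (\<forall>k\<in>{0..n - 2}.
              \<phi> (Coef k) p = Phi n f k p + (if k = 0 then Phi_h n h k p else 0)))"
proof -
  obtain f \<alpha> h where field: "affine_field f \<alpha> h \<xi> \<phi>" using determine_xi_eta unfolding affine_field_def by blast
  then have sm: "smooth_real (B Indep) f" "smooth_real (B Indep) \<alpha>" "smooth_real (B Indep) h" by (auto simp: affine_field_def)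
  obtain b0 where b0: "b0 \<in> base_space n B" using base_space_nonempty by blast
  have "((\<lambda>x. \<alpha> x - (real n - 1) / 2 * deriv f x) has_real_derivative 0) (at x within B Indep)"
    if x: "x \<in> B Indep" for x
  proof -
    have "real n * (deriv \<alpha> x - (real n - 1) / 2 * deriv (deriv f) x) = 0"
      using symmetry_components(1)[OF field base_upd[OF b0 Indep_in_jcoords x]]
      unfolding y_weight_subtop by (simp add: algebra_simps)
    then have "deriv \<alpha> x - (real n - 1) / 2 * deriv (deriv f) x = 0"
      using order_ge_2 by simp
    moreover have "((\<lambda>x. \<alpha> x - (real n - 1) / 2 * deriv f x) has_real_derivative
        deriv \<alpha> x - (real n - 1) / 2 * deriv (deriv f) x) (at x)"
      using smooth_real_has_derivative[OF sm(1) x, of 1] smooth_real_has_derivative[OF sm(2) x, of 0]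
      by (intro DERIV_diff DERIV_cmult) simp_all
    ultimately show ?thesis
      by (simp only: has_field_derivative_at_within)
  qed
  moreover have "convex (B Indep)" using sides[of Indep] is_interval_convex by auto
  ultimately obtain k1 where k1: "\<And>x. x \<in> B Indep \<Longrightarrow> \<alpha> x - (real n - 1) / 2 * deriv f x = k1"
    using has_field_derivative_zero_constant[of "B Indep" "\<lambda>x. \<alpha> x - (real n - 1) / 2 * deriv f x"] by blast
  then have \<alpha>: "\<alpha> x = (real n - 1) / 2 * deriv f x + k1" if "x \<in> B Indep" for x
    using that by (simp add: algebra_simps)
  show ?thesis
  proof (intro exI conjI ballI)
    fix b k assume b: "b \<in> base_space n B"
    have x: "b Indep \<in> B Indep" using b by (intro jet_regionD) (auto simp: base_space_alt)
    show "\<xi> b = f (b Indep)" using field b by (simp add: affine_field_def)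
    show "\<eta> b = b Y * ((real n - 1) / 2 * deriv f (b Indep) + k1) + h (b Indep)"
      using field b \<alpha>[OF x] by (simp add: affine_field_def)
    assume k: "k \<in> {0..n - 2}"
    have W: "y_weight f \<alpha> k b = - Phi n f k b"
    proof (rule y_weight_eq_Phi)
      show "k \<le> n" using k by auto
      show "(deriv ^^ j) \<alpha> (b Indep) = (real n - 1) / 2 * (deriv ^^ Suc j) f (b Indep) + (if j = 0 then k1 else 0)" for j
        by (rule affine_coefficient(2)[OF sm(1) _ x]) (rule \<alpha>)
    qed
    show "\<phi> (Coef k) b = Phi n f k b + (if k = 0 then Phi_h n h k b else 0)"
    proof (cases "k = 0")
      case True
      have "b Y * (\<phi> (Coef 0) b - Phi n f 0 b - Phi_h n h 0 b) = 0"
        using symmetry_components(3)[OF field b] W Phi_h_times_y[of b h, OF y_ne_0[OF b]] True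
        by (simp add: algebra_simps)
      then show ?thesis using y_ne_0[OF b] True by simp
    next
      case False
      then show ?thesis
        using symmetry_components(2)[OF field b, of k] W k order_ge_2 by auto
    qed
  qed (fact sm)+
qed

end

section \<open>Sufficiency\<close>

text \<open>Sums of products of smooth functions of a single base coordinate form a class that is closed
  under partial derivatives and contains the components of all fields in question.\<close>

inductive separable :: "nat \<Rightarrow> (jcoord \<Rightarrow> real set) \<Rightarrow> (jet \<Rightarrow> real) \<Rightarrow> bool" for n B where
  coord: "i \<in> jcoords n 0 \<Longrightarrow> smooth_real (B i) u \<Longrightarrow> separable n B (\<lambda>p. u (p i))"
| add: "separable n B F \<Longrightarrow> separable n B G \<Longrightarrow> separable n B (\<lambda>p. F p + G p)"
| mult: "separable n B F \<Longrightarrow> separable n B G \<Longrightarrow> separable n B (\<lambda>p. F p * G p)"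

context jet_box
begin

abbreviation "sep \<equiv> separable n B"

lemma sep_x: "smooth_real (B Indep) u \<Longrightarrow> sep (\<lambda>p. u (p Indep))"
  by (rule coord) simp_all

lemma sep_const: "sep (\<lambda>_. c)"
  using sep_x[OF smooth_real_const[OF open_side[OF Indep_in_jcoords]]] .

lemma sep_ident: "i \<in> jcoords n 0 \<Longrightarrow> sep (\<lambda>p. p i)"
  using coord[OF _ smooth_real_ident[OF open_side]] .

lemma sep_minus: "sep F \<Longrightarrow> sep (\<lambda>p. - F p)"
  using mult[OF sep_const[of "- 1"]] by simp

lemma sep_sum: "finite A \<Longrightarrow> (\<And>a. a \<in> A \<Longrightarrow> sep (F a)) \<Longrightarrow> sep (\<lambda>p. \<Sum>a\<in>A. F a p)"
proof (induction A rule: finite_induct)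
  case (insert a A)
  then show ?case using add[of n B "F a" "\<lambda>p. \<Sum>a\<in>A. F a p"] by simp
qed (simp add: sep_const)

lemma sep_pd:
  assumes "sep F" "i \<in> jcoords n 0"
  shows "\<exists>G. sep G \<and> (\<forall>p\<in>R. ((\<lambda>t. F (p(i := t))) has_real_derivative G p) (at (p i)))"
  using assms(1)
proof induction
  case (coord k u)
  show ?case
  proof (cases "k = i")
    case True
    have "sep (\<lambda>p. (deriv ^^ 1) u (p i))"
      by (rule separable.coord[OF assms(2)], rule smooth_real_deriv[OF open_side[OF assms(2)]])
        (use coord True in simp)
    moreover have "((\<lambda>t. u ((p(i := t)) k)) has_real_derivative (deriv ^^ 1) u (p i)) (at (p i))" if "p \<in> R" for p
      using smooth_real_has_derivative[OF coord(2), of "p k" 0] jet_regionD[OF that coord(1)] True by simp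
    ultimately show ?thesis by blast
  next
    case False
    then show ?thesis by (intro exI[of _ "\<lambda>_. 0"]) (auto intro: sep_const)
  qed
next
  case (add F G)
  then obtain F' G' where *: "sep F'" "sep G'"
    "\<And>p. p \<in> R \<Longrightarrow> ((\<lambda>t. F (p(i := t))) has_real_derivative F' p) (at (p i))"
    "\<And>p. p \<in> R \<Longrightarrow> ((\<lambda>t. G (p(i := t))) has_real_derivative G' p) (at (p i))" by blast
  show ?case
    by (intro exI[of _ "\<lambda>p. F' p + G' p"] conjI ballI separable.add DERIV_add *)
next
  case (mult F G)
  then obtain F' G' where *: "sep F'" "sep G'"
    "\<And>p. p \<in> R \<Longrightarrow> ((\<lambda>t. F (p(i := t))) has_real_derivative F' p) (at (p i))"
    "\<And>p. p \<in> R \<Longrightarrow> ((\<lambda>t. G (p(i := t))) has_real_derivative G' p) (at (p i))" by blast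
  show ?case
  proof (intro exI[of _ "\<lambda>p. F' p * G p + G' p * F p"] conjI ballI)
    show "sep (\<lambda>p. F' p * G p + G' p * F p)"
      using * mult by (intro separable.add separable.mult)
    show "((\<lambda>t. F (p(i := t)) * G (p(i := t))) has_real_derivative F' p * G p + G' p * F p) (at (p i))" if "p \<in> R" for p
      using DERIV_mult[OF *(3,4)[OF that]] by simp
  qed
qed

lemma sep_continuous: "sep F \<Longrightarrow> continuous_on R F"
proof (induction rule: separable.induct)
  case (coord i u)
  have "continuous_on (B i) u"
    using smooth_real_has_derivative[OF coord(2), of _ 0]
    by (intro continuous_at_imp_continuous_on ballI) (auto intro: DERIV_isCont)
  then show ?case
    by (rule continuous_on_compose2[of "B i" u R "\<lambda>p. p i"])
      (use coord jet_regionD in \<open>auto intro: continuous_on_product_coordinates continuous_on_subset\<close>)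
qed (intro continuous_intros; assumption)+

text \<open>Agreement on the box suffices, because partial derivatives at its points are determined by
  the values inside it.\<close>

lemma smooth_base_if_sep:
  assumes "sep F" "\<And>p. p \<in> base_space n B \<Longrightarrow> G p = F p"
  shows "smooth_base n B G"
proof -
  have deriv: "((\<lambda>t. H (p(i := t))) has_real_derivative D) (at (p i))"
    if "\<And>p. p \<in> base_space n B \<Longrightarrow> H p = F p" "i \<in> jcoords n 0" "p \<in> base_space n B"
      "((\<lambda>t. F (p(i := t))) has_real_derivative D) (at (p i))" for H F p i D
  proof (rule has_field_derivative_transform_within_open[OF that(4) open_side[OF that(2)]])
    show "p i \<in> B i" using that(2,3) by (simp add: base_space_alt jet_regionD)
    show "F (p(i := t)) = H (p(i := t))" if "t \<in> B i" for t
      using \<open>\<And>p. p \<in> base_space n B \<Longrightarrow> H p = F p\<close>[OF base_upd[OF \<open>p \<in> base_space n B\<close> \<open>i \<in> jcoords n 0\<close> that]] by simp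
  qed
  have ex: "\<exists>F. sep F \<and> (\<forall>p\<in>base_space n B. foldr pd js G p = F p)" if "set js \<subseteq> jcoords n 0" for js
    using that
  proof (induction js)
    case Nil
    then show ?case using assms by auto
  next
    case (Cons i js)
    then obtain F where F: "sep F" "\<And>p. p \<in> base_space n B \<Longrightarrow> foldr pd js G p = F p" by auto
    obtain F' where F': "sep F'" "\<And>p. p \<in> R \<Longrightarrow> ((\<lambda>t. F (p(i := t))) has_real_derivative F' p) (at (p i))"
      using sep_pd[OF F(1), of i] Cons.prems by auto
    have "pd i (foldr pd js G) p = F' p" if "p \<in> base_space n B" for p
      by (rule pd_eqI, rule deriv[OF F(2) _ that F'(2)]) (use Cons.prems that in \<open>auto simp: base_space_alt\<close>)
    then show ?case using F'(1) by auto
  qed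
  show ?thesis
    unfolding smooth_base_def
  proof (intro allI impI conjI ballI)
    fix js assume "set js \<subseteq> jcoords n 0"
    from ex[OF this] obtain F where F: "sep F" "\<And>p. p \<in> base_space n B \<Longrightarrow> foldr pd js G p = F p" by auto
    have "continuous_on (base_space n B) F"
      by (rule continuous_on_subset[OF sep_continuous[OF F(1)]]) (auto simp: base_space_alt)
    moreover have "continuous_on (base_space n B) (foldr pd js G) \<longleftrightarrow> continuous_on (base_space n B) F"
      by (rule continuous_on_cong) (simp_all add: F(2))
    ultimately show "continuous_on (base_space n B) (foldr pd js G)" by simp
    fix i p assume ip: "i \<in> jcoords n 0" "p \<in> base_space n B"
    obtain F' where F': "\<And>p. p \<in> R \<Longrightarrow> ((\<lambda>t. F (p(i := t))) has_real_derivative F' p) (at (p i))"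
      using sep_pd[OF F(1) ip(1)] by auto
    have "((\<lambda>t. foldr pd js G (p(i := t))) has_real_derivative F' p) (at (p i))"
      by (rule deriv[OF F(2) ip F']) (use ip in \<open>auto simp: base_space_alt\<close>)
    then show "(\<lambda>t. foldr pd js G (p(i := t))) differentiable (at (p i))"
      by (auto simp: real_differentiable_def)
  qed
qed

lemma sep_coef:
  assumes "m \<le> n"
  shows "sep (\<lambda>p. coef n p m)"
proof (cases "m < n - 1")
  case True
  then have "m \<noteq> n" "m + 1 \<noteq> n" by linarith+
  then have "(\<lambda>p. coef n p m) = (\<lambda>p. p (Jet (Coef m) 0))" by (simp add: coef_def)
  then show ?thesis using sep_ident[of "Jet (Coef m) 0"] True by simp
next
  case False
  then have "(\<lambda>p. coef n p m) = (\<lambda>_. if m = n then 1 else 0)"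
    using assms by (auto simp: coef_def)
  then show ?thesis using sep_const by simp
qed

lemma sep_deriv: "smooth_real (B Indep) f \<Longrightarrow> sep (\<lambda>p. (deriv ^^ j) f (p Indep))"
  by (intro sep_x smooth_real_deriv open_side) simp

lemma sep_Phi:
  assumes "smooth_real (B Indep) f" "k \<le> n"
  shows "sep (Phi n f k)"
proof -
  have "sep (\<lambda>p. deriv f (p Indep))"
    using sep_deriv[OF assms(1), of 1] by simp
  then show ?thesis
    unfolding Phi_def[abs_def]
    by (intro add sep_sum mult sep_const sep_coef sep_deriv[OF assms(1)]) (use assms(2) in auto)
qed

lemma sep_Phi_h:
  assumes "smooth_real (B Indep) h" "0 \<notin> B (Jet DepY 0)" "k \<le> n"
  shows "sep (Phi_h n h k)"
proof -
  have y: "sep (\<lambda>p. 1 / p (Jet DepY 0))"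
    using coord[of "Jet DepY 0" n B "\<lambda>y. 1 / y"] smooth_real_inverse[OF open_side assms(2)] by simp
  have h: "sep (\<lambda>p. (deriv ^^ j) h (p Indep) / p (Jet DepY 0))" for j
    using mult[OF sep_deriv[OF assms(1)] y] by simp
  have "sep (\<lambda>p. h (p Indep) / p (Jet DepY 0))"
    using h[of 0] by simp
  then show ?thesis
    unfolding Phi_h_def[abs_def]
    by (intro sep_minus add sep_sum mult sep_const sep_coef h) (use assms(3) in auto)
qed

text \<open>On \<open>\<Delta> = 0\<close> the sum in \<open>symmetry_sum_affine\<close> reduces to the terms \<open>- y\<^sup>(\<^sup>k\<^sup>) \<phi>\<^sub>k\<close>,
  with the inhomogeneous part in \<open>h\<close> absorbed by the summand for \<open>k = 0\<close>.\<close>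

lemma generator_GS_if_form:
  assumes y0: "0 \<notin> B (Jet DepY 0)" and f: "smooth_real (B Indep) f" and h: "smooth_real (B Indep) h"
    and form: "\<And>p. p \<in> base_space n B \<Longrightarrow>
           \<xi> p = f (p Indep) \<and>
           \<phi> DepY p =
             p (Jet DepY 0) * ((real n - 1) / 2 * deriv f (p Indep) + k1) + h (p Indep) \<and>
           (\<forall>k\<in>{0..n - 2}.
              \<phi> (Coef k) p = Phi n f k p + (if k = 0 then Phi_h n h k p else 0))"
  shows "generator_GS n B \<xi> \<phi>"
proof -
  define \<alpha> where "\<alpha> x = (real n - 1) / 2 * deriv f x + k1" for x
  have sm: "smooth_real (B Indep) \<alpha>"
    by (rule affine_coefficient(1)[OF f]) (simp add: \<alpha>_def)
  have d\<alpha>: "(deriv ^^ j) \<alpha> x = (real n - 1) / 2 * (deriv ^^ Suc j) f x + (if j = 0 then k1 else 0)"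
    if "x \<in> B Indep" for x j
    by (rule affine_coefficient(2)[OF f _ that]) (simp add: \<alpha>_def)
  have field: "affine_field f \<alpha> h \<xi> \<phi>"
    using sm f h form by (simp add: affine_field_def) (simp add: \<alpha>_def)
  have Coef: "\<phi> (Coef k) p = Phi n f k p + (if k = 0 then Phi_h n h 0 p else 0)"
    if "p \<in> base_space n B" "k < n - 1" for p k
    using form[OF that(1)] that(2) by auto
  show ?thesis
    unfolding generator_GS_alt
  proof (intro conjI ballI impI)
    show "smooth_base n B \<xi>"
      by (rule smooth_base_if_sep[OF sep_x[OF f]]) (use form in simp)
    show "smooth_base n B (\<phi> v)" if "v \<in> dvars n" for v
    proof (cases v)
      case DepY
      have "sep (\<lambda>p. \<alpha> (p Indep) * p (Jet DepY 0) + h (p Indep))"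
        by (intro add mult sep_x h sm sep_ident) simp
      then show ?thesis
        by (rule smooth_base_if_sep) (use field DepY in \<open>simp add: affine_field_def\<close>)
    next
      case (Coef k)
      then have k: "k < n - 1" using that by simp
      have "sep (\<lambda>p. Phi n f k p + (if k = 0 then Phi_h n h 0 p else 0))"
        using k by (cases "k = 0") (auto intro!: add sep_const sep_Phi[OF f] sep_Phi_h[OF h y0])
      then show ?thesis
        by (rule smooth_base_if_sep) (use \<open>\<And>p k. p \<in> base_space n B \<Longrightarrow> k < n - 1 \<Longrightarrow> \<phi> (Coef k) p = _\<close> k Coef in simp)
    qed
    fix p assume p: "p \<in> R" and D: "Delta n p = 0"
    let ?b = "base n p"
    have b: "?b \<in> base_space n B" by (rule base_in[OF p])
    have x: "p Indep \<in> B Indep" by (rule jet_regionD[OF p]) simp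
    have y: "?b (Jet DepY 0) \<noteq> 0"
      using jet_regionD[OF p, of "Jet DepY 0"] y0 by auto
    have same: "?b Indep = p Indep" "?b (Jet DepY 0) = p (Jet DepY 0)" by simp_all
    have c: "coef n ?b k = coef n p k" if "k \<le> n" for k
      by (rule coef_cong[OF that]) simp
    have W: "y_weight f \<alpha> k p = - Phi n f k ?b" if "k \<le> n" for k
    proof -
      have "Phi n f k ?b = Phi n f k p" by (rule Phi_cong[OF that]) simp_all
      moreover have "y_weight f \<alpha> k p = - Phi n f k p"
        by (rule y_weight_eq_Phi[OF that]) (rule d\<alpha>[OF x])
      ultimately show ?thesis by simp
    qed
    have top: "y_weight f \<alpha> (n - 1) p = 0"
      using d\<alpha>[OF x, of 1] unfolding y_weight_subtop by simp
    have H: "Phi_h n h 0 ?b * p (Jet DepY 0) = - (\<Sum>k\<le>n. coef n p k * (deriv ^^ k) h (p Indep))"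
      using Phi_h_times_y[of ?b h, OF y] c by (simp add: same)
    have n: "n = Suc (n - 1)" using order_ge_2 by simp
    have "(\<Sum>k<n. p (Jet DepY k) * y_weight f \<alpha> k p) = (\<Sum>k<n - 1. p (Jet DepY k) * y_weight f \<alpha> k p)"
      using sum.lessThan_Suc[of "\<lambda>k. p (Jet DepY k) * y_weight f \<alpha> k p" "n - 1"]
      unfolding n[symmetric] top by simp
    also have "\<dots> = - (\<Sum>k<n - 1. p (Jet DepY k) * Phi n f k ?b)"
      unfolding sum_negf[symmetric] by (intro sum.cong refl) (simp add: W)
    finally have "prolong_y \<xi> \<phi> n p + (\<Sum>k<n - 1. p (Jet (Coef k) 0) * prolong_y \<xi> \<phi> k p) =
      - (\<Sum>k<n - 1. p (Jet DepY k) * Phi n f k ?b) - Phi_h n h 0 ?b * p (Jet DepY 0)"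
      unfolding symmetry_sum_affine[OF field p] D H by simp
    moreover have "(\<Sum>k<n - 1. \<phi> (Coef k) ?b * p (Jet DepY k)) =
      (\<Sum>k<n - 1. p (Jet DepY k) * Phi n f k ?b) + Phi_h n h 0 ?b * p (Jet DepY 0)"
    proof -
      have "(\<Sum>k<n - 1. \<phi> (Coef k) ?b * p (Jet DepY k)) =
        (\<Sum>k<n - 1. p (Jet DepY k) * Phi n f k ?b + (if k = 0 then Phi_h n h 0 ?b * p (Jet DepY 0) else 0))"
        by (intro sum.cong refl) (simp add: Coef[OF b] algebra_simps)
      then show ?thesis using order_ge_2 by (simp add: sum.distrib)
    qed
    ultimately show "prolong_y \<xi> \<phi> n p + (\<Sum>k<n - 1. p (Jet (Coef k) 0) * prolong_y \<xi> \<phi> k p)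
        + (\<Sum>k<n - 1. \<phi> (Coef k) (base n p) * p (Jet DepY k)) = 0"
      by simp
  qed
qed

theorem generator_GS_iff:
  assumes y0: "0 \<notin> B (Jet DepY 0)"
  shows "generator_GS n B \<xi> \<phi> \<longleftrightarrow>
      (\<exists>f h k\<^sub>1. smooth_real (B Indep) f \<and> smooth_real (B Indep) h \<and>
        (\<forall>p\<in>base_space n B.
           \<xi> p = f (p Indep) \<and>
           \<phi> DepY p =
             p (Jet DepY 0) * ((real n - 1) / 2 * deriv f (p Indep) + k\<^sub>1) + h (p Indep) \<and>
           (\<forall>k\<in>{0..n - 2}.
              \<phi> (Coef k) p = Phi n f k p + (if k = 0 then Phi_h n h k p else 0))))"
  (is "?L \<longleftrightarrow> ?R")
proof
  assume ?L
  interpret symmetry n B \<xi> \<phi> by unfold_locales (fact \<open>?L\<close> y0)+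
  show ?R by (rule symmetry_form)
next
  assume ?R
  then obtain f h k1 where fh: "smooth_real (B Indep) f" "smooth_real (B Indep) h"
    and form: "\<forall>p\<in>base_space n B. \<xi> p = f (p Indep) \<and>
           \<phi> DepY p = p (Jet DepY 0) * ((real n - 1) / 2 * deriv f (p Indep) + k1) + h (p Indep) \<and>
           (\<forall>k\<in>{0..n - 2}. \<phi> (Coef k) p = Phi n f k p + (if k = 0 then Phi_h n h k p else 0))"
    by blast
  show ?L by (rule generator_GS_if_form[OF y0 fh]) (rule bspec[OF form])
qed

section \<open>The induced group on the coefficients\<close>

lemma coef_space_extend:
  assumes "q \<in> coef_space n B"
  obtains p where "p \<in> base_space n B" "restrict p (coef_coords n) = q"
proof -
  obtain b where b: "b \<in> base_space n B" using base_space_nonempty by blast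
  let ?p = "\<lambda>i. if i \<in> coef_coords n then q i else b i"
  have sub: "coef_coords n \<subseteq> jcoords n 0" by (auto simp: coef_coords_def)
  have q: "q i \<in> B i" if "i \<in> coef_coords n" for i
    using assms that by (auto simp: coef_space_def)
  have "?p \<in> R" using b q by (auto simp: jet_region_def base_space_alt)
  moreover have "base n ?p = ?p"
    using b sub by (auto simp: base_space_alt base_def fun_eq_iff restrict_def)
  moreover have "restrict ?p (coef_coords n) = q"
    using assms by (auto simp: coef_space_def PiE_def extensional_def fun_eq_iff)
  ultimately show ?thesis using that base_space_alt by blast
qed

lemma restrict_in_coef_space:
  assumes "p \<in> base_space n B"
  shows "restrict p (coef_coords n) \<in> coef_space n B"
  using assms jet_regionD[of p] by (auto simp: coef_space_def base_space_alt coef_coords_def)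

lemma Phi_restrict:
  assumes "k \<le> n"
  shows "Phi n f k (restrict p (coef_coords n)) = Phi n f k p"
  by (rule Phi_cong[OF assms]) (auto simp: coef_coords_def)

theorem generator_Gc_iff:
  assumes y0: "0 \<notin> B (Jet DepY 0)"
  shows "generator_Gc n B \<zeta> \<psi> \<longleftrightarrow>
      (\<exists>f. smooth_real (B Indep) f \<and>
        (\<forall>q\<in>coef_space n B.
           \<zeta> q = f (q Indep) \<and> (\<forall>k\<in>{0..n - 2}. \<psi> k q = Phi n f k q)))"
proof
  assume "generator_Gc n B \<zeta> \<psi>"
  then obtain \<xi> \<phi> where gen: "generator_GS n B \<xi> \<phi>" and proj: "projects_to_generator_G n B \<xi> \<phi>"
    and drop: "\<And>p. p \<in> base_space n B \<Longrightarrow> \<xi> p = \<zeta> (restrict p (coef_coords n)) \<and>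
           (\<forall>k<n - 1. \<phi> (Coef k) p = \<psi> k (restrict p (coef_coords n)))"
    unfolding generator_Gc_def by blast
  from gen[unfolded generator_GS_iff[OF y0]] obtain f h k1
    where f: "smooth_real (B Indep) f" and h: "smooth_real (B Indep) h"
      and form: "\<And>p. p \<in> base_space n B \<Longrightarrow> \<xi> p = f (p Indep) \<and>
           \<phi> DepY p = p (Jet DepY 0) * ((real n - 1) / 2 * deriv f (p Indep) + k1) + h (p Indep) \<and>
           (\<forall>k\<in>{0..n - 2}. \<phi> (Coef k) p = Phi n f k p + (if k = 0 then Phi_h n h k p else 0))"
    by blast
  from proj obtain g k2 where proj:
    "\<And>p. p \<in> base_space n B \<Longrightarrow> \<xi> p = g (p Indep) \<and>
       \<phi> DepY p = p (Jet DepY 0) * ((real n - 1) / 2 * deriv g (p Indep) + k2)"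
    unfolding projects_to_generator_G_def by blast
  obtain b0 where b0: "b0 \<in> base_space n B" using base_space_nonempty by blast
  \<comment> \<open>Both expressions for the component along \<open>y\<close> are affine in \<open>y\<close>, and \<open>y\<close> takes two values.\<close>
  have h0: "h x = 0" if x: "x \<in> B Indep" for x
  proof -
    define b where "b = b0(Indep := x)"
    have b: "b \<in> base_space n B" unfolding b_def by (rule base_upd[OF b0 _ x]) simp
    have bx: "b Indep = x" by (simp add: b_def)
    have "open (B (Jet DepY 0))" by (simp add: open_side)
    moreover have yb: "b (Jet DepY 0) \<in> B (Jet DepY 0)"
      using b by (simp add: base_space_alt jet_regionD)
    ultimately have "B (Jet DepY 0) \<noteq> {b (Jet DepY 0)}" using not_open_singleton by metis
    then obtain t where t: "t \<in> B (Jet DepY 0)" "t \<noteq> b (Jet DepY 0)" using yb by blast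
    have b': "b(Jet DepY 0 := t) \<in> base_space n B" by (rule base_upd[OF b _ t(1)]) simp
    define u where "u = ((real n - 1) / 2 * deriv f x + k1) - ((real n - 1) / 2 * deriv g x + k2)"
    have "b (Jet DepY 0) * u + h x = 0" "t * u + h x = 0"
      using form[OF b] proj[OF b] form[OF b'] proj[OF b'] by (simp_all add: u_def bx algebra_simps)
    moreover from this have "(t - b (Jet DepY 0)) * u = 0" by algebra
    ultimately show ?thesis using t(2) by simp
  qed
  have "Phi_h n h k p = 0" if "p \<in> base_space n B" for p k
  proof -
    have x: "p Indep \<in> B Indep" using that by (simp add: base_space_alt jet_regionD)
    have "(deriv ^^ j) h (p Indep) = 0" for j
      by (rule iterated_deriv_zero[OF open_side h0 x]) simp_all
    then show ?thesis using h0[OF x] by (simp add: Phi_h_def)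
  qed
  then have Coef: "\<phi> (Coef k) p = Phi n f k p" if "p \<in> base_space n B" "k \<le> n - 2" for p k
    using form[OF that(1)] that by auto
  show "\<exists>f. smooth_real (B Indep) f \<and> (\<forall>q\<in>coef_space n B.
           \<zeta> q = f (q Indep) \<and> (\<forall>k\<in>{0..n - 2}. \<psi> k q = Phi n f k q))"
  proof (intro exI[of _ f] conjI ballI f)
    fix q k assume "q \<in> coef_space n B"
    then obtain p where p: "p \<in> base_space n B" "restrict p (coef_coords n) = q"
      by (rule coef_space_extend)
    have "q Indep = p Indep" using p(2) by (auto simp: coef_coords_def)
    then show "\<zeta> q = f (q Indep)" using form[OF p(1)] drop[OF p(1)] p(2) by simp
    assume k: "k \<in> {0..n - 2}"
    then show "\<psi> k q = Phi n f k q"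
      using Coef[OF p(1), of k] drop[OF p(1)] p(2) Phi_restrict[of k f p] order_ge_2 by auto
  qed
next
  assume "\<exists>f. smooth_real (B Indep) f \<and> (\<forall>q\<in>coef_space n B.
           \<zeta> q = f (q Indep) \<and> (\<forall>k\<in>{0..n - 2}. \<psi> k q = Phi n f k q))"
  then obtain f where f: "smooth_real (B Indep) f"
    and form: "\<And>q. q \<in> coef_space n B \<Longrightarrow> \<zeta> q = f (q Indep) \<and> (\<forall>k\<in>{0..n - 2}. \<psi> k q = Phi n f k q)"
    by blast
  define \<xi> where "\<xi> p = f (p Indep)" for p :: jet
  define \<phi> where "\<phi> v p = (case v of
      DepY \<Rightarrow> p (Jet DepY 0) * ((real n - 1) / 2 * deriv f (p Indep) + 0) | Coef k \<Rightarrow> Phi n f k p)" for v and p :: jet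
  have "generator_GS n B \<xi> \<phi>"
  proof (rule generator_GS_if_form[OF y0 f smooth_real_const])
    have "(deriv ^^ j) (\<lambda>_. 0 :: real) x = 0" for j x
      by (rule iterated_deriv_zero[of UNIV]) simp_all
    then have "Phi_h n (\<lambda>_. 0) k p = 0" for k p by (simp add: Phi_h_def)
    then show "\<xi> p = f (p Indep) \<and>
           \<phi> DepY p = p (Jet DepY 0) * ((real n - 1) / 2 * deriv f (p Indep) + 0) + 0 \<and>
           (\<forall>k\<in>{0..n - 2}. \<phi> (Coef k) p = Phi n f k p + (if k = 0 then Phi_h n (\<lambda>_. 0) k p else 0))"
      if "p \<in> base_space n B" for p
      by (simp add: \<xi>_def \<phi>_def)
  qed (simp add: open_side)
  moreover have "projects_to_generator_G n B \<xi> \<phi>"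
    unfolding projects_to_generator_G_def
    by (intro exI[of _ f] exI[of _ 0]) (simp add: f \<xi>_def \<phi>_def)
  moreover have "\<xi> p = \<zeta> (restrict p (coef_coords n)) \<and>
      (\<forall>k<n - 1. \<phi> (Coef k) p = \<psi> k (restrict p (coef_coords n)))" if "p \<in> base_space n B" for p
  proof -
    have "restrict p (coef_coords n) Indep = p Indep" by (simp add: coef_coords_def)
    then show ?thesis
      using form[OF restrict_in_coef_space[OF that]] Phi_restrict[of _ f p]
      by (auto simp: \<xi>_def \<phi>_def)
  qed
  ultimately show "generator_Gc n B \<zeta> \<psi>" unfolding generator_Gc_def by blast
qed

end

theorem theorem2:
  fixes n :: nat and B :: "jcoord \<Rightarrow> real set"
    and \<xi> \<zeta> :: "jet \<Rightarrow> real" and \<phi> :: "dvar \<Rightarrow> jet \<Rightarrow> real" and \<psi> :: "nat \<Rightarrow> jet \<Rightarrow> real"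
  assumes "n \<ge> 2"
    and "\<And>i. i \<in> jcoords n 0 \<Longrightarrow> open (B i) \<and> is_interval (B i) \<and> B i \<noteq> {}"
    and "0 \<notin> B (Jet DepY 0)"
  shows "(generator_GS n B \<xi> \<phi> \<longleftrightarrow>
      (\<exists>f h k\<^sub>1. smooth_real (B Indep) f \<and> smooth_real (B Indep) h \<and>
        (\<forall>p\<in>base_space n B.
           \<xi> p = f (p Indep) \<and>
           \<phi> DepY p =
             p (Jet DepY 0) * ((real n - 1) / 2 * deriv f (p Indep) + k\<^sub>1) + h (p Indep) \<and>
           (\<forall>k\<in>{0..n - 2}.
              \<phi> (Coef k) p = Phi n f k p + (if k = 0 then Phi_h n h k p else 0)))))
    \<and> (generator_Gc n B \<zeta> \<psi> \<longleftrightarrow>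
      (\<exists>f. smooth_real (B Indep) f \<and>
        (\<forall>q\<in>coef_space n B.
           \<zeta> q = f (q Indep) \<and> (\<forall>k\<in>{0..n - 2}. \<psi> k q = Phi n f k q))))"
proof -
  interpret jet_box n B by unfold_locales (fact assms)+
  show ?thesis
    using generator_GS_iff[OF assms(3)] generator_Gc_iff[OF assms(3)] by (rule conjI)
qed

end
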